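(* Let $V$ satisfy the assumptions in the context. Then there is exactly one real sequence $(\chi(i))_{i\ge0}$ with $\chi(0)=0$ such that $$0=\sum_{\substack{k=0\\k\ne i}}^\infty V'\big(\chi(i)-\chi(k)\big)\quad\text{for all } i=1,2,3,\dots,$$ and such that the sequence $\epsilon(i):=\chi(i)-\chi(i-1)-1$, $i\ge1$, satisfies $\epsilon\in\ell^2(\mathbb{N})$ and $\epsilon(i)\ge-1$ for all $i\ge1$.
   Context: $\mathbb{N}=\{1,2,3,\dots\}$ and $\ell^2(\mathbb{N})$ is the space of real square-summable sequences. **Assumptions on the potential.** $V:\mathbb{R}\to[0,+\infty]$ satisfies: - $V:\mathbb{R}\setminus\{0\}\to(0,+\infty)$ is even and $C^2$; - $V(x)\to V(0)=+\infty$ as $x\downarrow0$ or $x\uparrow 0$; - for each $x\in(0,+\infty)$ there exists $\lambda(x)>0$ such that $\inf_{(0,x)}V''\ge\lambda(x)$; - $V(x),V'(x)\to0$ as $|x|\to\infty$, and there exist $a>\tfrac32$ and constants $c_\delta$ such that for any $\delta>0$, $V''(x)\le c_\delta|x|^{-a-2}$ for all $x\in\mathbb{R}\setminus(-\delta,\delta)$. Since $V'$ is only defined on $\mathbb{R}\setminus\{0\}$, a solution of the system is understood to have $\chi(i)\ne\chi(k)$ whenever $i\ne k$. *)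

theory Defs
  imports "HOL-Analysis.Analysis"
begin

definition pot_deriv :: "(real \<Rightarrow> ennreal) \<Rightarrow> real \<Rightarrow> real" where
  "pot_deriv V = deriv (\<lambda>x. enn2real (V x))"

definition pot_deriv2 :: "(real \<Rightarrow> ennreal) \<Rightarrow> real \<Rightarrow> real" where
  "pot_deriv2 V = deriv (pot_deriv V)"

text \<open>Derivatives are those of the real-valued function \<open>enn2real \<circ> V\<close>; only their values off the
  origin, where the potential is finite, are ever used.\<close>

definition admissible_potential :: "(real \<Rightarrow> ennreal) \<Rightarrow> bool" where
  "admissible_potential V \<longleftrightarrow>
     (\<forall>x. x \<noteq> 0 \<longrightarrow> 0 < V x \<and> V x < \<infinity>) \<and>
     (\<forall>x. V (- x) = V x) \<and>
     (\<forall>x. x \<noteq> 0 \<longrightarrow> (\<lambda>y. enn2real (V y)) field_differentiable at x) \<and>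
     (\<forall>x. x \<noteq> 0 \<longrightarrow> pot_deriv V field_differentiable at x) \<and>
     continuous_on (- {0}) (pot_deriv2 V) \<and>
     V 0 = \<infinity> \<and> (V \<longlongrightarrow> V 0) (at 0) \<and>
     (\<forall>x>0. \<exists>l>0. \<forall>y\<in>{0<..<x}. l \<le> pot_deriv2 V y) \<and>
     (V \<longlongrightarrow> 0) at_infinity \<and> (pot_deriv V \<longlongrightarrow> 0) at_infinity \<and>
     (\<exists>a>3/2. \<exists>c :: real \<Rightarrow> real. \<forall>\<delta>>0. \<forall>x. x \<notin> {-\<delta><..<\<delta>} \<longrightarrow>
        pot_deriv2 V x \<le> c \<delta> * \<bar>x\<bar> powr (- a - 2))"

text \<open>Sequences over \<open>{1, 2, 3, \<dots>}\<close> are functions on \<^typ>\<open>nat\<close> whose value at \<open>0\<close> is irrelevant.\<close>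

definition ell2 :: "(nat \<Rightarrow> real) set" where
  "ell2 = {f. (\<lambda>i. (f i)\<^sup>2) summable_on {1..}}"

definition spacing_excess :: "(nat \<Rightarrow> real) \<Rightarrow> nat \<Rightarrow> real" where
  "spacing_excess chi i = chi i - chi (i - 1) - 1"

text \<open>The force balance is an ordinary series over \<open>k = 0, 1, 2, \<dots>\<close> with the term \<open>k = i\<close> dropped;
  \<open>sums\<close> asserts both convergence and the value. Injectivity keeps every other argument of the
  derivative away from the singularity.\<close>

definition force_balanced :: "(real \<Rightarrow> ennreal) \<Rightarrow> (nat \<Rightarrow> real) \<Rightarrow> bool" where
  "force_balanced V chi \<longleftrightarrow> inj chi \<and>
     (\<forall>i\<ge>1. (\<lambda>k. if k = i then 0 else pot_deriv V (chi i - chi k)) sums 0)"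

end

theory Submission imports Defs begin

text \<open>Uniqueness: let \<open>d\<close> be the difference of two solutions and test the difference of the two force
  balances at \<open>1, \<dots>, N\<close> with \<open>d\<close>. By convexity the interactions inside \<open>{0, \<dots>, N}\<close> contribute
  nonnegatively, and increasingly in \<open>N\<close>; the interactions across the bond \<open>(N, N + 1)\<close> tend to 0
  because the increments of \<open>d\<close> are square summable. Hence every increment vanishes.

  Existence: minimise the energy of the finite chain with the ends pinned at \<open>0\<close> and \<open>N\<close> and compare
  with the lattice \<open>i \<mapsto> i\<close>. The force on particle \<open>i\<close> of the finite lattice is a difference of tails
  \<open>\<tau> i - \<tau> (N - i)\<close> with \<open>\<tau> i = O(i\<^sup>-\<^sup>a)\<close>, and \<open>\<Sum>i. sqrt i * \<tau> i\<close> converges for \<open>a > 3/2\<close>. This bounds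
  the linear part of the energy difference by the \<open>\<ell>\<^sup>2\<close> norm of the negative part of the spacing excess,
  so the excesses are bounded in \<open>\<ell>\<^sup>2\<close> and the spacings stay in a compact subset of \<open>(0, \<infinity>)\<close>, uniformly
  in \<open>N\<close>. A pointwise limit along a subsequence is then a solution, by dominated convergence.\<close>

section \<open>Sums and decaying convex potentials\<close>

text \<open>Summation by pairs: by antisymmetry the two ordered entries of a pair combine into one
  term, and the induction step adds one row and one column. With \<open>A\<close> as forces, it
  turns a sum over bonds into the forces tested with \<open>d\<close>.\<close>

lemma sum_pairs_antisym:
  fixes A :: "nat \<Rightarrow> nat \<Rightarrow> real"
  assumes "\<And>i k. A k i = - A i k"
  shows "(\<Sum>m\<le>N. \<Sum>j<m. A m j * (d m - d j)) = (\<Sum>i\<le>N. d i * (\<Sum>k\<le>N. A i k))"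
proof (induction N)
  case 0
  have "A 0 0 = 0" using assms[of 0 0] by simp
  then show ?case by simp
next
  case (Suc N)
  have diag: "A (Suc N) (Suc N) = 0" using assms[of "Suc N" "Suc N"] by simp
  have "(\<Sum>i\<le>Suc N. d i * (\<Sum>k\<le>Suc N. A i k))
      = (\<Sum>i\<le>N. d i * (\<Sum>k\<le>N. A i k)) + (\<Sum>i\<le>N. d i * A i (Suc N))
        + d (Suc N) * (\<Sum>k\<le>N. A (Suc N) k)"
    by (simp add: diag distrib_left sum.distrib)
  moreover have "(\<Sum>i\<le>N. d i * A i (Suc N)) = - (\<Sum>j\<le>N. A (Suc N) j * d j)"
    unfolding sum_negf[symmetric]
    by (intro sum.cong refl) (simp add: assms[of "Suc N"] mult.commute)
  moreover have "(\<Sum>j<Suc N. A (Suc N) j * (d (Suc N) - d j))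
      = d (Suc N) * (\<Sum>k\<le>N. A (Suc N) k) - (\<Sum>j\<le>N. A (Suc N) j * d j)"
    by (simp add: lessThan_Suc_atMost right_diff_distrib sum_subtractf sum_distrib_left mult.commute)
  ultimately show ?case using Suc by simp
qed

text \<open>Dominated convergence for series: for fixed \<open>r\<close> the term tends to 0, and
  \<open>w r\<close> times a bound of \<open>y\<close> dominates it. In the uniqueness proof
  \<open>r\<close> is the distance to a bond that moves off to infinity.\<close>

lemma convolution_tendsto_0:
  fixes w y :: "nat \<Rightarrow> real"
  assumes "summable w" "\<And>n. 0 \<le> w n" "y \<longlonglongrightarrow> 0"
  shows "(\<lambda>N. \<Sum>r\<le>N. w r * y (N - r)) \<longlonglongrightarrow> 0"
proof -
  define f where "f r N = (if r \<le> N then w r * y (N - r) else 0)" for r N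
  obtain Y where Y: "\<And>n. norm (y n) \<le> Y"
    using convergent_imp_Bseq[OF convergentI[OF assms(3)]] by (metis BseqE)
  have "(\<lambda>N. \<Sum>r. f r N) \<longlonglongrightarrow> (\<Sum>r. 0)"
  proof (rule tannerys_theorem[where M = "\<lambda>r. w r * Y", THEN conjunct2, THEN conjunct2])
    fix r
    have "(\<lambda>N. w r * y (N - r)) \<longlonglongrightarrow> w r * 0"
      by (intro tendsto_mult tendsto_const) (use assms(3) in \<open>simp add: LIMSEQ_offset[of _ r]\<close>)
    moreover have "eventually (\<lambda>N. w r * y (N - r) = f r N) sequentially"
      using eventually_ge_at_top[of r] by eventually_elim (simp add: f_def)
    ultimately show "(\<lambda>N. f r N) \<longlonglongrightarrow> 0"
      using Lim_transform_eventually by fastforce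
  next
    have "norm (f r N) \<le> w r * Y" for r N
      using Y[of "N - r"] assms(2)[of r] order_trans[OF norm_ge_zero Y]
      by (auto simp: f_def abs_mult intro!: mult_left_mono)
    then show "\<forall>\<^sub>F (k, n) in sequentially \<times>\<^sub>F sequentially. norm (f k n) \<le> w k * Y"
      by (intro always_eventually) auto
  qed (use assms in \<open>auto intro: summable_mult2\<close>)
  moreover have "(\<Sum>r. f r N) = (\<Sum>r\<le>N. w r * y (N - r))" for N
    by (subst suminf_finite[of "{..N}"]) (auto simp: f_def)
  ultimately show ?thesis by simp
qed

section \<open>Power laws and their antiderivatives\<close>

lemma summable_Suc_powr:
  assumes "s < -1"
  shows "summable (\<lambda>n. real (Suc n) powr s)"
  using assms summable_real_powr_iff[of s] summable_Suc_iff[of "\<lambda>n. real n powr s"] by simp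

lemma DERIV_powr_neg:
  fixes s C :: real
  assumes "x > 0" "s > 0"
  shows "((\<lambda>t. C / s * t powr (- s)) has_real_derivative - C * x powr (- s - 1)) (at x)"
  using assms by (auto intro!: derivative_eq_intros)

lemma powr_neg_at_top:
  fixes s C :: real
  assumes "s > 0"
  shows "((\<lambda>t. C / s * t powr (- s)) \<longlongrightarrow> 0) at_top"
proof -
  have "((\<lambda>t. C / s * t powr (- s)) \<longlongrightarrow> C / s * 0) at_top"
    by (intro tendsto_mult tendsto_const tendsto_neg_powr) (use assms in \<open>auto simp: filterlim_ident\<close>)
  then show ?thesis by simp
qed

text \<open>Adding the antiderivative of the bound to \<open>h\<close> gives a nonincreasing
  function with limit 0, hence a nonnegative one. Two applications carry the decay of
  \<open>v2\<close> over to \<open>v1\<close> and then to \<open>v\<close>.\<close>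

lemma antideriv_bound_at_top:
  fixes h h' :: "real \<Rightarrow> real"
  assumes "\<delta> > 0" "x \<ge> \<delta>" and s: "s > 0"
    and D: "\<And>t. t \<ge> \<delta> \<Longrightarrow> (h has_real_derivative h' t) (at t)"
    and le: "\<And>t. t \<ge> \<delta> \<Longrightarrow> h' t \<le> C * t powr (- s - 1)"
    and lim: "(h \<longlongrightarrow> 0) at_top"
  shows "- h x \<le> C / s * x powr (- s)"
proof -
  define g where "g t = h t + C / s * t powr (- s)" for t
  have "(g has_real_derivative h' t + - C * t powr (- s - 1)) (at t)" if "t \<ge> \<delta>" for t
    unfolding g_def by (intro DERIV_add D DERIV_powr_neg) (use that assms in auto)
  moreover have "h' t + - C * t powr (- s - 1) \<le> 0" if "t \<ge> \<delta>" for t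
    using le[OF that] by simp
  ultimately have "g y \<le> g x" if "y \<ge> x" for y
    by (intro DERIV_nonpos_imp_nonincreasing[OF that]) (use \<open>x \<ge> \<delta>\<close> in \<open>blast intro: order_trans\<close>)
  then have "eventually (\<lambda>y. g y \<le> g x) at_top"
    unfolding eventually_at_top_linorder by blast
  moreover have "(g \<longlongrightarrow> 0 + 0) at_top"
    unfolding g_def by (intro tendsto_add lim powr_neg_at_top s)
  ultimately have "0 \<le> g x" by (metis add_0 tendsto_upperbound trivial_limit_at_top_linorder)
  then show ?thesis by (simp add: g_def)
qed

text \<open>The potential is described on the positive half-line; since it is even, negative
  arguments enter through \<open>v1_odd\<close> alone.\<close>

locale decaying_convex_potential =
  fixes v v1 v2 :: "real \<Rightarrow> real" and a :: real
  assumes v_pos: "x > 0 \<Longrightarrow> v x > 0"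
    and DERIV_v: "x > 0 \<Longrightarrow> (v has_real_derivative v1 x) (at x)"
    and DERIV_v1: "x > 0 \<Longrightarrow> (v1 has_real_derivative v2 x) (at x)"
    and v1_odd: "x \<noteq> 0 \<Longrightarrow> v1 (- x) = - v1 x"
    and v_at_0: "filterlim v at_top (at_right 0)"
    and v_at_top: "(v \<longlongrightarrow> 0) at_top"
    and v1_at_top: "(v1 \<longlongrightarrow> 0) at_top"
    and v2_lower: "x > 0 \<Longrightarrow> \<exists>l>0. \<forall>y\<in>{0<..<x}. l \<le> v2 y"
    and v2_upper: "\<delta> > 0 \<Longrightarrow> \<exists>C. \<forall>x\<ge>\<delta>. v2 x \<le> C * x powr (- a - 2)"
    and a_gt: "a > 3/2"
begin

section \<open>Signs, decay and convexity estimates\<close>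

lemma v2_pos: "x > 0 \<Longrightarrow> v2 x > 0"
  using v2_lower[of "x + 1"] by (auto intro: less_le_trans)

lemma v2_upper_pos:
  assumes "\<delta> > 0"
  obtains C where "C > 0" "\<And>x. x \<ge> \<delta> \<Longrightarrow> v2 x \<le> C * x powr (- a - 2)"
proof -
  obtain C where C: "\<And>x. x \<ge> \<delta> \<Longrightarrow> v2 x \<le> C * x powr (- a - 2)"
    using v2_upper[OF assms] by blast
  have "0 < C * \<delta> powr (- a - 2)" using v2_pos[OF assms] C[of \<delta>] by simp
  then have "C > 0" using assms by (simp add: zero_less_mult_iff)
  with C show ?thesis using that by blast
qed

lemma v1_less:
  assumes "0 < x" "x < y"
  shows "v1 x < v1 y"
proof (rule DERIV_pos_imp_increasing[OF assms(2)])
  fix t assume "x \<le> t"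
  then show "\<exists>y. (v1 has_real_derivative y) (at t) \<and> 0 < y"
    using DERIV_v1[of t] v2_pos[of t] assms by auto
qed

text \<open>\<open>v1\<close> increases strictly towards its limit 0.\<close>

lemma v1_neg:
  assumes "x > 0"
  shows "v1 x < 0"
proof -
  have "eventually (\<lambda>y. v1 (x + 1) \<le> v1 y) at_top"
    using eventually_gt_at_top[of "x + 1"]
    by eventually_elim (use assms v1_less[of "x + 1"] in \<open>auto intro: less_imp_le\<close>)
  then have "v1 (x + 1) \<le> 0" using v1_at_top by (metis tendsto_lowerbound trivial_limit_at_top_linorder)
  then show ?thesis using v1_less[of x "x + 1"] assms by simp
qed

lemma v1_mono: "0 < x \<Longrightarrow> x \<le> y \<Longrightarrow> v1 x \<le> v1 y"
  using v1_less[of x y] by (cases "x = y") auto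

lemma v1_decay:
  assumes "\<delta> > 0"
  obtains C where "C > 0" "\<And>x. x \<ge> \<delta> \<Longrightarrow> - v1 x \<le> C * x powr (- a - 1)"
proof -
  obtain C where C: "C > 0" "\<And>x. x \<ge> \<delta> \<Longrightarrow> v2 x \<le> C * x powr (- a - 2)"
    using v2_upper_pos[OF assms] by blast
  have "- v1 x \<le> C / (a + 1) * x powr (- (a + 1))" if "x \<ge> \<delta>" for x
    by (rule antideriv_bound_at_top[OF assms that _ DERIV_v1 _ v1_at_top])
       (use assms a_gt C in \<open>auto simp: algebra_simps\<close>)
  moreover have "- (a + 1) = - a - 1" by simp
  ultimately have "- v1 x \<le> C / (a + 1) * x powr (- a - 1)" if "x \<ge> \<delta>" for x
    using that by metis
  moreover have "C / (a + 1) > 0" using C a_gt by simp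
  ultimately show ?thesis using that by blast
qed

lemma v_decay:
  assumes "\<delta> > 0"
  obtains C where "C > 0" "\<And>x. x \<ge> \<delta> \<Longrightarrow> v x \<le> C * x powr (- a)"
proof -
  obtain C where C: "C > 0" "\<And>x. x \<ge> \<delta> \<Longrightarrow> - v1 x \<le> C * x powr (- a - 1)"
    using v1_decay[OF assms] by blast
  \<comment> \<open>Here the bound is applied to \<open>- v\<close>, whose derivative
    \<open>- v1\<close> has just been estimated.\<close>
  have "- (- v x) \<le> C / a * x powr (- a)" if "x \<ge> \<delta>" for x
    by (rule antideriv_bound_at_top[OF assms that _ DERIV_minus[OF DERIV_v]])
       (use assms a_gt C tendsto_minus[OF v_at_top] in auto)
  moreover have "C / a > 0" using C a_gt by simp
  ultimately show ?thesis using that by auto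
qed

text \<open>Mean value bound on \<open>{q..}\<close>, where the power law is largest at
  \<open>q\<close>. Keeping \<open>q\<close> apart from \<open>\<delta>\<close> makes the Lipschitz
  constant decay with the distance while \<open>C\<close> stays fixed.\<close>

lemma v1_Lipschitz:
  assumes C: "C > 0" "\<And>x. x \<ge> \<delta> \<Longrightarrow> v2 x \<le> C * x powr (- a - 2)"
    and "0 < \<delta>" "\<delta> \<le> q" "q \<le> x" "q \<le> y"
  shows "\<bar>v1 x - v1 y\<bar> \<le> C * q powr (- a - 2) * \<bar>x - y\<bar>"
proof -
  have "norm (v1 x - v1 y) \<le> C * q powr (- a - 2) * norm (x - y)"
  proof (rule field_differentiable_bound[of "{q..}"])
    fix z assume "z \<in> {q..}"
    then have z: "z \<ge> q" by simp
    then show "(v1 has_field_derivative v2 z) (at z within {q..})"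
      using DERIV_v1[of z] assms by (auto intro: has_field_derivative_at_within)
    have "v2 z \<le> C * z powr (- a - 2)" using C(2) z assms by simp
    also have "\<dots> \<le> C * q powr (- a - 2)"
      using C(1) z assms a_gt by (auto intro!: mult_left_mono powr_mono2')
    finally show "norm (v2 z) \<le> C * q powr (- a - 2)"
      using v2_pos[of z] z assms by simp
  qed (use assms in auto)
  then show ?thesis by simp
qed

text \<open>Strong convexity on \<open>(0, R)\<close>: the derivative of the difference
  \<open>f\<close> of the two sides has the sign of \<open>t - x\<close>, so \<open>f\<close> is
  smallest at \<open>x\<close>, where it vanishes.\<close>

lemma v_ge_tangent_quadratic:
  assumes l: "\<And>y. 0 < y \<Longrightarrow> y < R \<Longrightarrow> l \<le> v2 y"
    and "0 < x" "x < R" "0 < y" "y < R"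
  shows "l / 2 * (y - x)\<^sup>2 \<le> v y - v x - v1 x * (y - x)"
proof -
  define f where "f t = v t - v x - v1 x * (t - x) - l / 2 * (t - x)\<^sup>2" for t
  have D: "(f has_real_derivative v1 t - v1 x - l * (t - x)) (at t)" if "t > 0" for t
    unfolding f_def using that by (auto intro!: derivative_eq_intros DERIV_v)
  have slope: "l * (t - s) \<le> v1 t - v1 s" if st: "0 < s" "s < t" "t < R" for s t
  proof -
    obtain z where "s < z" "z < t" "v1 t - v1 s = (t - s) * v2 z"
      using MVT2[OF st(2), of v1 v2] DERIV_v1 st by force
    then show ?thesis using l[of z] st by (simp add: mult.commute mult_left_mono)
  qed
  have "f x \<le> f y"
  proof (cases "x \<le> y")
    case True
    then show ?thesis
    proof (rule DERIV_nonneg_imp_nondecreasing[of x y f])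
      fix t assume t: "x \<le> t" "t \<le> y"
      have "0 \<le> v1 t - v1 x - l * (t - x)"
        using slope[of x t] t assms by (cases "t = x") (auto simp: algebra_simps)
      then show "\<exists>y. (f has_real_derivative y) (at t) \<and> 0 \<le> y"
        using D[of t] t assms by auto
    qed
  next
    case False
    show ?thesis
    proof (rule DERIV_nonpos_imp_nonincreasing[of y x f])
      show "y \<le> x" using False by simp
      fix t assume t: "y \<le> t" "t \<le> x"
      have "v1 t - v1 x - l * (t - x) \<le> 0"
        using slope[of t x] t assms by (cases "t = x") (auto simp: algebra_simps)
      then show "\<exists>y. (f has_real_derivative y) (at t) \<and> y \<le> 0"
        using D[of t] t assms by auto
    qed
  qed
  then show ?thesis by (simp add: f_def)
qed

lemma v_ge_tangent:
  assumes "0 < x" "0 < y"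
  shows "v y - v x - v1 x * (y - x) \<ge> 0"
  using v_ge_tangent_quadratic[of "x + y" 0 x y] assms v2_pos by (force intro: less_imp_le)

end

section \<open>Uniqueness of balanced chains\<close>

lemma gap_le:
  fixes chi :: "nat \<Rightarrow> real"
  assumes "\<And>i. j \<le> i \<Longrightarrow> i < m \<Longrightarrow> c \<le> chi (Suc i) - chi i" "j \<le> m"
  shows "c * (real m - real j) \<le> chi m - chi j"
proof -
  have "c * (real m - real j) = (\<Sum>i\<in>{j..<m}. c)"
    using assms(2) by (simp add: of_nat_diff)
  also have "\<dots> \<le> (\<Sum>i\<in>{j..<m}. chi (Suc i) - chi i)"
    by (intro sum_mono) (use assms(1) in auto)
  also have "\<dots> = chi m - chi j" using assms(2) by (rule sum_Suc_diff')
  finally show ?thesis .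
qed

text \<open>Cauchy-Schwarz on the telescoped difference. Bounding by the tail from \<open>j\<close>
  on, not by the full norm, gains a factor that tends to 0 as \<open>j\<close> grows.\<close>

lemma difference_sq_le_tail:
  fixes d :: "nat \<Rightarrow> real"
  assumes "summable (\<lambda>p. (d (Suc p) - d p)\<^sup>2)" "j \<le> m"
  shows "(d m - d j)\<^sup>2 \<le> (real m - real j) * (\<Sum>p. (d (Suc (p + j)) - d (p + j))\<^sup>2)"
proof -
  have "(d m - d j)\<^sup>2 = (\<Sum>p\<in>{j..<m}. d (Suc p) - d p)\<^sup>2"
    using assms(2) by (simp add: sum_Suc_diff')
  also have "\<dots> \<le> (\<Sum>p\<in>{j..<m}. (d (Suc p) - d p)\<^sup>2) * card {j..<m}"
    by (rule sum_squared_le_sum_of_squares)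
  also have "(\<Sum>p\<in>{j..<m}. (d (Suc p) - d p)\<^sup>2) = (\<Sum>p<m-j. (d (Suc (p + j)) - d (p + j))\<^sup>2)"
    using sum.shift_bounds_nat_ivl[of "\<lambda>p. (d (Suc p) - d p)\<^sup>2" 0 j "m - j"] assms(2)
    by (simp add: atLeast0LessThan)
  also have "\<dots> * card {j..<m} \<le> (\<Sum>p. (d (Suc (p + j)) - d (p + j))\<^sup>2) * card {j..<m}"
    using summable_ignore_initial_segment[OF assms(1), of j]
    by (intro mult_right_mono sum_le_suminf) auto
  finally show ?thesis using assms(2) by (simp add: of_nat_diff mult.commute)
qed

lemma suminf_tail_tendsto_0:
  fixes f :: "nat \<Rightarrow> real"
  assumes "summable f"
  shows "(\<lambda>n. \<Sum>p. f (p + n)) \<longlonglongrightarrow> 0"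
proof -
  have "(\<lambda>n. suminf f - sum f {..<n}) \<longlonglongrightarrow> suminf f - suminf f"
    by (intro tendsto_diff tendsto_const summable_LIMSEQ assms)
  then show ?thesis by (simp add: suminf_minus_initial_segment[OF assms])
qed

text \<open>The square of \<open>r + t + 1\<close> is at least \<open>(r + 1) * (t + 1)\<close>.
  This decouples the two sides of a bond: particles \<open>r\<close> sites to its left and
  \<open>t\<close> sites to its right interact over the distance \<open>r + t + 1\<close>.\<close>

lemma powr_le_product:
  assumes "s > 0"
  shows "real (r + t + 1) powr (- s) \<le> real (Suc r) powr (- (s / 2)) * real (Suc t) powr (- (s / 2))"
proof -
  have "real (r + t + 1) powr (- s) = (real (r + t + 1) * real (r + t + 1)) powr (- (s / 2))"
    by (simp add: powr_mult powr_add[symmetric] del: of_nat_add)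
  also have "\<dots> \<le> (real (Suc r) * real (Suc t)) powr (- (s / 2))"
    using assms by (intro powr_mono2' mult_mono) auto
  also have "\<dots> = real (Suc r) powr (- (s / 2)) * real (Suc t) powr (- (s / 2))"
    by (simp add: powr_mult)
  finally show ?thesis .
qed

context decaying_convex_potential
begin

text \<open>Both chains have distances at least \<open>c * (m - j)\<close>, so the Lipschitz bound
  applies with this value as \<open>q\<close>.\<close>

lemma force_difference_bound:
  fixes chi psi :: "nat \<Rightarrow> real"
  assumes "c > 0" "\<And>i. c \<le> chi (Suc i) - chi i" "\<And>i. c \<le> psi (Suc i) - psi i"
  obtains C where "C > 0" "\<And>j m. j < m \<Longrightarrow> \<bar>v1 (chi m - chi j) - v1 (psi m - psi j)\<bar>
     \<le> C * (real m - real j) powr (- a - 2) * \<bar>(chi m - psi m) - (chi j - psi j)\<bar>"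
proof -
  obtain C where C: "C > 0" "\<And>x. x \<ge> c \<Longrightarrow> v2 x \<le> C * x powr (- a - 2)"
    using v2_upper_pos[OF assms(1)] by blast
  have "\<bar>v1 (chi m - chi j) - v1 (psi m - psi j)\<bar>
     \<le> C * c powr (- a - 2) * (real m - real j) powr (- a - 2) * \<bar>(chi m - psi m) - (chi j - psi j)\<bar>"
    if "j < m" for j m
  proof -
    have "\<bar>v1 (chi m - chi j) - v1 (psi m - psi j)\<bar>
       \<le> C * (c * (real m - real j)) powr (- a - 2) * \<bar>(chi m - chi j) - (psi m - psi j)\<bar>"
    proof (rule v1_Lipschitz[OF C assms(1)])
      show "c \<le> c * (real m - real j)" using assms(1) that by simp
    qed (use gap_le[of j m c] assms that in auto)
    also have "(c * (real m - real j)) powr (- a - 2) = c powr (- a - 2) * (real m - real j) powr (- a - 2)"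
      using assms(1) that by (simp add: powr_mult)
    finally show ?thesis by (simp add: algebra_simps)
  qed
  moreover have "C * c powr (- a - 2) > 0" using C assms by simp
  ultimately show ?thesis using that by blast
qed

lemma force_balance_unique:
  fixes chi psi :: "nat \<Rightarrow> real"
  assumes "c > 0" and gaps: "\<And>i. c \<le> chi (Suc i) - chi i" "\<And>i. c \<le> psi (Suc i) - psi i"
    and start: "chi 0 = psi 0"
    and balance: "\<And>i. i \<ge> 1 \<Longrightarrow> (\<lambda>k. if k = i then 0 else v1 (chi i - chi k)) sums 0"
      "\<And>i. i \<ge> 1 \<Longrightarrow> (\<lambda>k. if k = i then 0 else v1 (psi i - psi k)) sums 0"
    and l2: "summable (\<lambda>p. ((chi (Suc p) - psi (Suc p)) - (chi p - psi p))\<^sup>2)"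
  shows "chi = psi"
proof -
  define d where "d i = chi i - psi i" for i
  define A where "A i k = (if k = i then 0 else v1 (chi i - chi k) - v1 (psi i - psi k))" for i k
  define T where "T n = (\<Sum>p. (d (Suc (p + n)) - d (p + n))\<^sup>2)" for n
  \<comment> \<open>Half of the exponent \<open>a + 1\<close> goes to each side of a bond; it still
    exceeds 1, so \<open>w\<close> is summable.\<close>
  define w where "w n = real (Suc n) powr (- ((a + 1) / 2))" for n
  define W where "W = suminf w"
  \<comment> \<open>\<open>R N i\<close> collects the force differences between particle
    \<open>i\<close> and all particles beyond \<open>N\<close>.\<close>
  define R where "R N i = (\<Sum>s. A (N + 1 + s) i)" for N i
  have l2': "summable (\<lambda>p. (d (Suc p) - d p)\<^sup>2)" using l2 by (simp add: d_def)
  have T0: "T \<longlonglongrightarrow> 0" using suminf_tail_tendsto_0[OF l2'] by (simp add: T_def[abs_def])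
  have T_nonneg: "0 \<le> T n" for n
    unfolding T_def by (intro suminf_nonneg) (use summable_ignore_initial_segment[OF l2', of n] in auto)
  have w_nonneg: "0 \<le> w n" for n by (simp add: w_def)
  have w_summable: "summable w"
    unfolding w_def[abs_def] by (rule summable_Suc_powr) (use a_gt in simp)
  have pos: "chi m - chi j > 0" "psi m - psi j > 0" if "j < m" for j m
  proof -
    have "0 < c * (real m - real j)" using that \<open>c > 0\<close> by simp
    then show "chi m - chi j > 0" "psi m - psi j > 0"
      using gap_le[of j m c chi] gap_le[of j m c psi] gaps that by (auto intro: less_le_trans)
  qed
  have anti: "A k i = - A i k" for i k
  proof -
    have "chi i - chi k \<noteq> 0" "psi i - psi k \<noteq> 0" if "i \<noteq> k"
      using pos[of i k] pos[of k i] that by (cases "i < k"; force)+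
    then show ?thesis
      using v1_odd[of "chi i - chi k"] v1_odd[of "psi i - psi k"] by (auto simp: A_def)
  qed
  have rows: "(\<lambda>k. A i k) sums 0" if "i \<ge> 1" for i
  proof -
    have "A i = (\<lambda>k. (if k = i then 0 else v1 (chi i - chi k)) - (if k = i then 0 else v1 (psi i - psi k)))"
      by (auto simp: A_def)
    then show ?thesis using sums_diff[OF balance[OF that]] by simp
  qed
  obtain C where "C > 0" and C: "\<And>j m. j < m \<Longrightarrow>
      \<bar>A m j\<bar> \<le> C * (real m - real j) powr (- a - 2) * \<bar>d m - d j\<bar>"
  proof (rule force_difference_bound[of c chi psi])
    fix C assume C: "C > 0" "\<And>j m. j < m \<Longrightarrow> \<bar>v1 (chi m - chi j) - v1 (psi m - psi j)\<bar>
       \<le> C * (real m - real j) powr (- a - 2) * \<bar>(chi m - psi m) - (chi j - psi j)\<bar>"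
    show thesis by (rule that[OF C(1)]) (use C(2) in \<open>auto simp: A_def d_def\<close>)
  qed (use \<open>c > 0\<close> gaps in auto)
  have d_le: "\<bar>d m - d j\<bar> \<le> sqrt (real m - real j) * sqrt (T j)" if "j \<le> m" for j m
    using difference_sq_le_tail[OF l2' that]
    by (metis T_def real_sqrt_abs real_sqrt_le_mono real_sqrt_mult)
  \<comment> \<open>\<open>r\<close> and \<open>s\<close> count sites to the left and right of the
    bond \<open>(N, N + 1)\<close>, and \<open>q\<close> is the distance. Each difference of
    \<open>d\<close> costs a factor \<open>sqrt q\<close>; two of them turn the decay
    \<open>q powr (- a - 2)\<close> into \<open>q powr (- a - 1)\<close>, which splits into
    \<open>w r * w s\<close>. The first bound has only one such factor and gives away another to
    obtain the same weights.\<close>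
  have bounds: "\<bar>A (N + 1 + s) (N - r)\<bar> \<le> C * w r * w s * sqrt (T (N - r))"
    "\<bar>d (N - r) - d N\<bar> * \<bar>A (N + 1 + s) (N - r)\<bar> \<le> C * w r * w s * T (N - r)"
    if "r \<le> N" for N r s
  proof -
    define q where "q = real (r + s + 1)"
    have q: "q \<ge> 1" by (simp add: q_def)
    have sqrt_q: "sqrt q \<le> q" by (rule real_le_lsqrt) (use q in \<open>auto simp: power2_eq_square\<close>)
    have diff: "real (N + 1 + s) - real (N - r) = q" using that by (simp add: q_def of_nat_diff)
    have qw: "q powr (- a - 2) * q \<le> w r * w s"
    proof -
      have "q powr (- a - 2) * q = q powr (- a - 2 + 1)" using q powr_add[of q "- a - 2" 1] by simp
      also have "\<dots> = q powr (- (a + 1))" by (simp add: algebra_simps)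
      also have "\<dots> \<le> w r * w s" unfolding q_def w_def using powr_le_product[of "a + 1" r s] a_gt by simp
      finally show ?thesis .
    qed
    have A: "\<bar>A (N + 1 + s) (N - r)\<bar> \<le> C * q powr (- a - 2) * \<bar>d (N + 1 + s) - d (N - r)\<bar>"
      using C[of "N - r" "N + 1 + s"] diff by simp
    also have "\<dots> \<le> C * q powr (- a - 2) * (sqrt q * sqrt (T (N - r)))"
      using d_le[of "N - r" "N + 1 + s"] \<open>C > 0\<close> diff by (intro mult_left_mono) auto
    finally have A': "\<bar>A (N + 1 + s) (N - r)\<bar> \<le> C * q powr (- a - 2) * (sqrt q * sqrt (T (N - r)))" .
    also have "\<dots> \<le> C * q powr (- a - 2) * (q * sqrt (T (N - r)))"
      using \<open>C > 0\<close> sqrt_q T_nonneg by (intro mult_left_mono mult_right_mono) auto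
    also have "\<dots> = C * sqrt (T (N - r)) * (q powr (- a - 2) * q)" by (simp add: mult_ac)
    also have "\<dots> \<le> C * sqrt (T (N - r)) * (w r * w s)"
      using qw \<open>C > 0\<close> T_nonneg by (intro mult_left_mono) auto
    finally show "\<bar>A (N + 1 + s) (N - r)\<bar> \<le> C * w r * w s * sqrt (T (N - r))" by (simp add: mult_ac)
    have "\<bar>d (N - r) - d N\<bar> \<le> sqrt (real r) * sqrt (T (N - r))"
      using d_le[of "N - r" N] that by (simp add: of_nat_diff abs_minus_commute)
    also have "\<dots> \<le> sqrt q * sqrt (T (N - r))"
      using T_nonneg by (intro mult_right_mono) (auto simp: q_def)
    finally have "\<bar>d (N - r) - d N\<bar> * \<bar>A (N + 1 + s) (N - r)\<bar>
        \<le> (sqrt q * sqrt (T (N - r))) * (C * q powr (- a - 2) * (sqrt q * sqrt (T (N - r))))"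
      using A' q T_nonneg by (intro mult_mono) auto
    also have "\<dots> = C * (sqrt q * sqrt q) * q powr (- a - 2) * (sqrt (T (N - r)) * sqrt (T (N - r)))"
      by (simp add: mult_ac)
    also have "\<dots> = C * T (N - r) * (q powr (- a - 2) * q)"
      using q T_nonneg by (simp add: mult_ac)
    also have "\<dots> \<le> C * T (N - r) * (w r * w s)"
      using qw \<open>C > 0\<close> T_nonneg by (intro mult_left_mono) auto
    finally show "\<bar>d (N - r) - d N\<bar> * \<bar>A (N + 1 + s) (N - r)\<bar> \<le> C * w r * w s * T (N - r)"
      by (simp add: mult_ac)
  qed
  have tail_summable: "summable (\<lambda>s. \<bar>A (N + 1 + s) i\<bar>)" if "i \<le> N" for N i
  proof (rule summable_comparison_test')
    show "summable (\<lambda>s. C * w (N - i) * sqrt (T i) * w s)"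
      by (intro summable_mult w_summable)
    show "norm \<bar>A (N + 1 + s) i\<bar> \<le> C * w (N - i) * sqrt (T i) * w s" for s
      using bounds(1)[of "N - i" N s] that by (simp add: mult_ac)
  qed
  \<comment> \<open>The factor \<open>b\<close> is 1 in the estimate of \<open>S\<close> and a
    difference of \<open>d\<close> in the estimate of \<open>P\<close>.\<close>
  have R_le: "b * \<bar>R N i\<bar> \<le> K * W" if "i \<le> N" "b \<ge> 0" "\<And>s. b * \<bar>A (N + 1 + s) i\<bar> \<le> K * w s" for b K N i
  proof -
    have "b * \<bar>R N i\<bar> \<le> b * (\<Sum>s. \<bar>A (N + 1 + s) i\<bar>)"
      unfolding R_def by (intro mult_left_mono summable_rabs tail_summable that)
    also have "\<dots> = (\<Sum>s. b * \<bar>A (N + 1 + s) i\<bar>)"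
      by (intro suminf_mult[symmetric] tail_summable that)
    also have "\<dots> \<le> (\<Sum>s. K * w s)"
      by (intro suminf_le that summable_mult w_summable tail_summable)
    also have "\<dots> = K * W" by (simp add: W_def suminf_mult[OF w_summable])
    finally show ?thesis .
  qed
  \<comment> \<open>A row sums to 0, so its part up to \<open>N\<close> is the negative of its part
    beyond \<open>N\<close>; antisymmetry absorbs the sign.\<close>
  have partial_row: "(\<Sum>k\<le>N. A i k) = R N i" if "1 \<le> i" "i \<le> N" for i N
  proof -
    have "(\<Sum>s. A i (s + Suc N)) = 0 - (\<Sum>k<Suc N. A i k)"
      using suminf_minus_initial_segment[of "A i" "Suc N"] rows[OF that(1)] by (simp add: sums_iff)
    moreover have "R N i = (\<Sum>s. - A i (s + Suc N))"
      unfolding R_def by (simp add: add.commute flip: anti)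
    moreover have "summable (\<lambda>s. A i (s + Suc N))"
      using rows[OF that(1)] by (intro summable_ignore_initial_segment) (simp add: sums_iff)
    ultimately show ?thesis by (simp add: suminf_minus lessThan_Suc_atMost)
  qed
  \<comment> \<open>\<open>S N\<close> is the difference of the stresses that the two chains transmit across the bond \<open>(N, N + 1)\<close>:
    force balance makes it independent of \<open>N\<close>, square summability makes it tend to 0.\<close>
  define S where "S N = (\<Sum>i\<le>N. R N i)" for N
  have S_Suc: "S (Suc N) = S N" for N
  proof -
    have "R N i = A (Suc N) i + R (Suc N) i" if "i \<le> N" for i
      using suminf_split_head[OF summable_rabs_cancel[OF tail_summable[OF that]]]
      by (simp add: R_def)
    then have "S N = (\<Sum>i\<le>N. A (Suc N) i) + (\<Sum>i\<le>N. R (Suc N) i)"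
      by (simp add: S_def sum.distrib)
    \<comment> \<open>Particle \<open>Suc N\<close> changes sides of the bond; its own force balance
      shows that the total is unaffected.\<close>
    also have "(\<Sum>i\<le>N. A (Suc N) i) = R (Suc N) (Suc N)"
      using partial_row[of "Suc N" "Suc N"] by (simp add: A_def)
    finally show ?thesis by (simp add: S_def)
  qed
  have rev: "(\<Sum>i\<le>N. g i) = (\<Sum>r\<le>N. g (N - r))" for g :: "nat \<Rightarrow> real" and N
    by (rule sum.reindex_bij_witness[of _ "\<lambda>r. N - r" "\<lambda>r. N - r"]) auto
  have S0: "S N = 0" for N
  proof -
    have "norm (S N) \<le> C * W * (\<Sum>r\<le>N. w r * sqrt (T (N - r)))" for N
    proof -
      have "norm (S N) \<le> (\<Sum>r\<le>N. \<bar>R N (N - r)\<bar>)"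
        unfolding S_def rev[of "R N"] by (simp add: sum_abs)
      also have "\<dots> \<le> (\<Sum>r\<le>N. C * w r * sqrt (T (N - r)) * W)"
      proof (rule sum_mono)
        fix r assume "r \<in> {..N}"
        then show "\<bar>R N (N - r)\<bar> \<le> C * w r * sqrt (T (N - r)) * W"
          using R_le[of "N - r" N 1 "C * w r * sqrt (T (N - r))"] bounds(1)[of r N]
          by (simp add: mult_ac)
      qed
      finally show ?thesis by (simp add: sum_distrib_left mult_ac)
    qed
    moreover have "(\<lambda>N. C * W * (\<Sum>r\<le>N. w r * sqrt (T (N - r)))) \<longlonglongrightarrow> C * W * 0"
      by (intro tendsto_mult tendsto_const convolution_tendsto_0[of w "\<lambda>n. sqrt (T n)"] w_summable w_nonneg)
         (use tendsto_real_sqrt[OF T0] in simp)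
    ultimately have "S \<longlonglongrightarrow> 0"
      by (intro Lim_null_comparison[of S]) auto
    moreover have const: "S n = S 0" for n by (induction n) (auto simp: S_Suc)
    then have "S = (\<lambda>_. S 0)" by (rule ext)
    ultimately have "S 0 = 0" by (metis LIMSEQ_const_iff)
    then show ?thesis using const by simp
  qed
  define P where "P N = (\<Sum>m\<le>N. \<Sum>j<m. A m j * (d m - d j))" for N
  \<comment> \<open>\<open>v1\<close> is strictly increasing, so the difference of the forces has
    the same sign as the difference \<open>d m - d j\<close> of the distances.\<close>
  have pair_term: "0 \<le> A m j * (d m - d j)" "d m \<noteq> d j \<Longrightarrow> 0 < A m j * (d m - d j)" if "j < m" for j m
  proof -
    have "0 < A m j * (d m - d j)" if "d m \<noteq> d j"
      using v1_less[of "chi m - chi j" "psi m - psi j"] v1_less[of "psi m - psi j" "chi m - chi j"]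
        pos[OF \<open>j < m\<close>] that \<open>j < m\<close>
      by (cases "d m < d j") (auto simp: A_def d_def intro: mult_neg_neg mult_pos_pos)
    then show "0 \<le> A m j * (d m - d j)" "d m \<noteq> d j \<Longrightarrow> 0 < A m j * (d m - d j)"
      by (cases "d m = d j"; force)+
  qed
  \<comment> \<open>As \<open>S N = 0\<close>, replacing the possibly unbounded \<open>d i\<close> by \<open>d i - d N\<close> is free of charge.\<close>
  have P_eq: "P N = (\<Sum>i\<le>N. (d i - d N) * R N i)" for N
  proof -
    have "P N = (\<Sum>i\<le>N. d i * (\<Sum>k\<le>N. A i k))"
      unfolding P_def by (rule sum_pairs_antisym) (rule anti)
    \<comment> \<open>Particle 0 obeys no force balance, but \<open>d 0 = 0\<close> removes its
      term.\<close>
    also have "\<dots> = (\<Sum>i\<le>N. d i * R N i)"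
    proof (intro sum.cong refl)
      fix i assume "i \<in> {..N}"
      then show "d i * (\<Sum>k\<le>N. A i k) = d i * R N i"
        using partial_row[of i N] start by (cases "i = 0") (auto simp: d_def)
    qed
    also have "\<dots> = (\<Sum>i\<le>N. d i * R N i) - d N * S N" by (simp add: S0)
    also have "\<dots> = (\<Sum>i\<le>N. (d i - d N) * R N i)"
      by (simp add: S_def sum_distrib_left sum_subtractf left_diff_distrib)
    finally show ?thesis .
  qed
  have "norm (P N) \<le> C * W * (\<Sum>r\<le>N. w r * T (N - r))" for N
  proof -
    have "norm (P N) \<le> (\<Sum>r\<le>N. \<bar>d (N - r) - d N\<bar> * \<bar>R N (N - r)\<bar>)"
      unfolding P_eq rev[of "\<lambda>i. (d i - d N) * R N i"]
      by (rule order_trans[OF norm_sum]) (simp add: abs_mult)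
    also have "\<dots> \<le> (\<Sum>r\<le>N. C * w r * T (N - r) * W)"
    proof (rule sum_mono)
      fix r assume "r \<in> {..N}"
      then show "\<bar>d (N - r) - d N\<bar> * \<bar>R N (N - r)\<bar> \<le> C * w r * T (N - r) * W"
        using R_le[of "N - r" N "\<bar>d (N - r) - d N\<bar>" "C * w r * T (N - r)"] bounds(2)[of r N]
        by (simp add: mult_ac)
    qed
    finally show ?thesis by (simp add: sum_distrib_left mult_ac)
  qed
  moreover have "(\<lambda>N. C * W * (\<Sum>r\<le>N. w r * T (N - r))) \<longlonglongrightarrow> C * W * 0"
    by (intro tendsto_mult tendsto_const convolution_tendsto_0 w_summable w_nonneg T0)
  ultimately have P_lim: "P \<longlonglongrightarrow> 0"
    by (intro Lim_null_comparison[of P]) auto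
  have P_mono: "P N \<le> P (Suc N)" for N
  proof -
    have "0 \<le> (\<Sum>j<Suc N. A (Suc N) j * (d (Suc N) - d j))"
      by (intro sum_nonneg pair_term) auto
    then show ?thesis by (simp add: P_def del: sum.lessThan_Suc)
  qed
  have P_le: "P N \<le> 0" for N
    using P_lim incseq_le[OF incseq_SucI[of P], OF P_mono] by blast
  \<comment> \<open>\<open>P\<close> vanishes, being a sum of nonnegative terms with
    \<open>P N \<le> 0\<close>. Its nearest-neighbour terms then carry \<open>d 0 = 0\<close> along
    the chain.\<close>
  have "d N = 0" for N
  proof (induction N)
    case 0
    then show ?case using start by (simp add: d_def)
  next
    case (Suc N)
    have "A (Suc N) N * (d (Suc N) - d N) \<le> (\<Sum>j<Suc N. A (Suc N) j * (d (Suc N) - d j))"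
      by (rule member_le_sum[of N "{..<Suc N}" "\<lambda>j. A (Suc N) j * (d (Suc N) - d j)"])
         (auto intro: pair_term)
    also have "\<dots> = P (Suc N) - P N" by (simp add: P_def del: sum.lessThan_Suc)
    also have "\<dots> \<le> 0"
    proof -
      have "0 \<le> P N" unfolding P_def by (intro sum_nonneg pair_term) auto
      then show ?thesis using P_le[of "Suc N"] by simp
    qed
    finally show ?case using pair_term(2)[of N "Suc N"] Suc by force
  qed
  then show ?thesis by (auto simp: d_def fun_eq_iff)
qed

end

section \<open>Existence of balanced chains\<close>

text \<open>Freezing the chain at \<open>N\<close> beyond index \<open>N\<close> bounds every
  coordinate, so that finite chains form compact sets in the one space of all sequences, where the
  limit in \<open>N\<close> is also taken. The closed constraint with \<open>c\<close> keeps the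
  energy away from its singularity.\<close>

definition pinned_chains :: "real \<Rightarrow> nat \<Rightarrow> (nat \<Rightarrow> real) set" where
  "pinned_chains c N =
     {chi. chi 0 = 0 \<and> (\<forall>k\<ge>N. chi k = real N) \<and> (\<forall>i<N. c \<le> chi (Suc i) - chi i)}"

text \<open>Tychonoff's theorem. The bound may depend on \<open>k\<close>: constant bounds serve the
  minimisation, linear ones the limit of long chains.\<close>

lemma compact_box:
  fixes b :: "nat \<Rightarrow> real"
  shows "compact {f :: nat \<Rightarrow> real. \<forall>k. 0 \<le> f k \<and> f k \<le> b k}"
proof -
  have "compactin (product_topology (\<lambda>_. euclidean) UNIV) (PiE UNIV (\<lambda>k. {0..b k}))"
    by (subst compactin_PiE) (auto simp: compact_Icc)
  moreover have "PiE UNIV (\<lambda>k. {0..b k}) = {f. \<forall>k. 0 \<le> f k \<and> f k \<le> b k}"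
    by (auto simp: PiE_def Pi_def)
  ultimately show ?thesis by (simp add: euclidean_product_topology)
qed

lemma pinned_chain_bounds:
  assumes "chi \<in> pinned_chains c N" "0 \<le> c"
  shows "0 \<le> chi k" "chi k \<le> real N"
proof -
  have gap: "c \<le> chi (Suc i) - chi i" if "i < N" for i using assms that by (simp add: pinned_chains_def)
  have ends: "chi 0 = 0" "\<And>k. k \<ge> N \<Longrightarrow> chi k = real N" using assms by (auto simp: pinned_chains_def)
  have "0 \<le> chi k \<and> chi k \<le> real N"
  proof (cases "k \<le> N")
    case True
    have "0 \<le> c * (real k - real 0)" "0 \<le> c * (real N - real k)" using True assms(2) by auto
    moreover have "c * (real k - real 0) \<le> chi k - chi 0" "c * (real N - real k) \<le> chi N - chi k"
      using True gap by (intro gap_le; auto)+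
    ultimately show ?thesis using ends(1) ends(2)[of N] by simp
  qed (use ends in simp)
  then show "0 \<le> chi k" "chi k \<le> real N" by auto
qed

lemma compact_pinned_chains:
  assumes "0 \<le> c"
  shows "compact (pinned_chains c N)"
proof -
  have cont: "continuous_on UNIV (\<lambda>chi :: nat \<Rightarrow> real. chi k)" for k
    by (rule continuous_on_product_coordinates)
  have "closed (pinned_chains c N)"
    unfolding pinned_chains_def imp_conv_disj
    by (intro closed_Collect_conj closed_Collect_all closed_Collect_disj closed_Collect_const
        closed_Collect_eq closed_Collect_le continuous_on_diff continuous_on_const cont)
  then have "compact ({f. \<forall>k. 0 \<le> f k \<and> f k \<le> real N} \<inter> pinned_chains c N)"
    by (rule compact_Int_closed[OF compact_box])
  moreover have "pinned_chains c N = {f. \<forall>k. 0 \<le> f k \<and> f k \<le> real N} \<inter> pinned_chains c N"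
    using pinned_chain_bounds[OF _ assms] by blast
  ultimately show ?thesis by argo
qed

section \<open>Forces in the finite lattice\<close>

context decaying_convex_potential
begin

text \<open>The strength of the total force from a half-line of lattice sites, all at distance
  greater than \<open>i\<close>; it is the tail written as tau in the overview.\<close>

definition tail_force :: "nat \<Rightarrow> real" where
  "tail_force i = (\<Sum>q. - v1 (real (q + i + 1)))"

text \<open>The tangent at \<open>Suc q\<close> lies below the graph at \<open>q\<close>. Summed up,
  the right-hand side telescopes, which bounds a tail of forces by one value of
  \<open>v\<close>.\<close>

lemma v1_le_difference:
  assumes "q \<ge> 1"
  shows "- v1 (real (Suc q)) \<le> v (real q) - v (real (Suc q))"
  using v_ge_tangent[of "real (Suc q)" "real q"] assms by simp

lemma tail_force_bounds:
  assumes "i \<ge> 1"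
  shows "summable (\<lambda>q. - v1 (real (q + i + 1)))" "0 \<le> tail_force i" "tail_force i \<le> v (real i)"
proof -
  have nonneg: "0 \<le> - v1 (real (q + i + 1))" for q
    using v1_neg[of "real (q + i + 1)"] by simp
  have le: "(\<Sum>q<n. - v1 (real (q + i + 1))) \<le> v (real i)" for n
  proof -
    have "(\<Sum>q<n. - v1 (real (q + i + 1))) \<le> (\<Sum>q<n. v (real (q + i)) - v (real (Suc q + i)))"
      using v1_le_difference[of "_ + i"] assms by (intro sum_mono) simp
    also have "\<dots> = v (real i) - v (real (n + i))"
      using sum_lessThan_telescope'[of "\<lambda>q. v (real (q + i))" n] by simp
    also have "\<dots> \<le> v (real i)" using v_pos[of "real (n + i)"] assms by simp
    finally show ?thesis .
  qed
  show summable: "summable (\<lambda>q. - v1 (real (q + i + 1)))"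
    by (rule summableI_nonneg_bounded[OF nonneg le])
  show "0 \<le> tail_force i" unfolding tail_force_def by (intro suminf_nonneg summable nonneg)
  show "tail_force i \<le> v (real i)" unfolding tail_force_def by (intro suminf_le_const summable le)
qed

lemma tail_force_Suc: "tail_force i = - v1 (real (Suc i)) + tail_force (Suc i)"
proof -
  have "summable (\<lambda>q. - v1 (real (q + Suc i + 1)))" by (rule tail_force_bounds) simp
  then have "summable (\<lambda>q. - v1 (real (Suc q + i + 1)))" by simp
  then have "summable (\<lambda>q. - v1 (real (q + i + 1)))"
    by (subst (asm) summable_Suc_iff[of "\<lambda>q. - v1 (real (q + i + 1))"])
  from suminf_split_head[OF this] show ?thesis by (simp add: tail_force_def)
qed

lemma tail_force_nonneg: "0 \<le> tail_force i"
proof (cases "i = 0")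
  case True
  then show ?thesis
    using tail_force_Suc[of 0] v1_neg[of 1] tail_force_bounds(2)[of 1] by simp
qed (use tail_force_bounds(2)[of i] in simp)

text \<open>This is the only place where the full strength of \<^term>\<open>a > 3/2\<close> is needed.\<close>

lemma summable_sqrt_tail_force: "summable (\<lambda>i. sqrt (real i) * tail_force i)"
proof -
  obtain C where C: "C > 0" "\<And>x. x \<ge> 1 \<Longrightarrow> v x \<le> C * x powr (- a)"
    using v_decay[of 1] by (metis zero_less_one)
  have "summable (\<lambda>i. C * real i powr (1/2 - a))"
    using a_gt by (intro summable_mult) (simp add: summable_real_powr_iff)
  moreover have "norm (sqrt (real i) * tail_force i) \<le> C * real i powr (1/2 - a)" for i
  proof (cases "i = 0")
    case False
    then have "tail_force i \<le> C * real i powr (- a)"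
      using tail_force_bounds(3)[of i] C(2)[of "real i"] by simp
    then have "sqrt (real i) * tail_force i \<le> real i powr (1/2) * (C * real i powr (- a))"
      by (simp add: powr_half_sqrt mult_left_mono)
    also have "\<dots> = C * real i powr (1/2 - a)"
      using powr_add[of "real i" "1/2" "- a"] by simp
    finally show ?thesis by (simp add: tail_force_nonneg)
  qed simp
  ultimately show ?thesis by (rule summable_comparison_test')
qed

text \<open>In the doubly infinite lattice all forces cancel, so what remains is the effect of the
  missing sites: those at distance more than \<open>i\<close> on the left and more than
  \<open>N - i\<close> on the right. The proof starts with \<open>i\<close> as the last site and
  adds sites on the right.\<close>

lemma lattice_force:
  assumes "i \<le> N"
  shows "(\<Sum>k\<le>N. if k = i then 0 else v1 (real i - real k)) = tail_force i - tail_force (N - i)"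
  using assms
proof (induction N rule: dec_induct)
  case base
  have "(\<Sum>k\<le>i. if k = i then 0 else v1 (real i - real k)) = (\<Sum>k<i. v1 (real (i - k)))"
    by (simp add: lessThan_Suc_atMost[symmetric] of_nat_diff)
  also have "\<dots> = (\<Sum>q<i. v1 (real (Suc q)))"
    by (rule sum.reindex_bij_witness[of _ "\<lambda>q. i - Suc q" "\<lambda>q. i - Suc q"]) auto
  also have "\<dots> = (\<Sum>q<i. tail_force (Suc q) - tail_force q)"
  proof (intro sum.cong refl)
    show "v1 (real (Suc q)) = tail_force (Suc q) - tail_force q" for q
      using tail_force_Suc[of q] by simp
  qed
  also have "\<dots> = tail_force i - tail_force 0" by (rule sum_lessThan_telescope)
  finally show ?case by simp
next
  case (step N)
  have neg: "real i - real (Suc N) = - real (Suc (N - i))" using step by (simp add: of_nat_diff)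
  have "v1 (real i - real (Suc N)) = - v1 (real (Suc (N - i)))"
    unfolding neg by (rule v1_odd) simp
  then show ?case
    using step tail_force_Suc[of "N - i"] by (simp add: Suc_diff_le)
qed

section \<open>Energy of pinned chains compared with the lattice\<close>

definition energy :: "nat \<Rightarrow> (nat \<Rightarrow> real) \<Rightarrow> real" where
  "energy N chi = (\<Sum>m\<le>N. \<Sum>j<m. v (chi m - chi j))"

text \<open>The convexity remainder of \<open>v\<close> at the lattice spacing 1. It blows up at 0
  and grows at least linearly at infinity, so a bound on it confines a spacing from both
  sides.\<close>

definition bond_excess :: "real \<Rightarrow> real" where
  "bond_excess s = v s - v 1 - v1 1 * (s - 1)"

lemma bond_excess_nonneg: "s > 0 \<Longrightarrow> 0 \<le> bond_excess s"
  unfolding bond_excess_def by (rule v_ge_tangent) auto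

text \<open>Expand the energy at the lattice and keep only nearest-neighbour remainders. In the
  linear part each pinned end gives a one-sided bound on the displacement, and its sign fits the
  tail it is paired with; so only compressed bonds enter \<open>D\<close>.\<close>

lemma energy_lower_bound:
  assumes ends: "chi 0 = 0" "chi N = real N" and gap: "\<And>i. i < N \<Longrightarrow> 0 < chi (Suc i) - chi i"
  defines "D \<equiv> sqrt (\<Sum>i<N. (min 0 (chi (Suc i) - chi i - 1))\<^sup>2)"
  shows "(\<Sum>i<N. bond_excess (chi (Suc i) - chi i)) - 2 * D * (\<Sum>i. sqrt (real i) * tail_force i)
     \<le> energy N chi - energy N real"
proof -
  define d where "d i = chi i - real i" for i
  define G where "G = (\<Sum>i. sqrt (real i) * tail_force i)"
  define F where "F m j = v (chi m - chi j) - v (real m - real j) - v1 (real m - real j) * (d m - d j)" for m j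
  define A where "A i k = (if k = i then 0 else v1 (real i - real k))" for i k
  have "D \<ge> 0" by (simp add: D_def sum_nonneg)
  have pos: "0 < chi m - chi j" if "j < m" "m \<le> N" for j m
  proof -
    have "(\<Sum>i\<in>{j..<m}. chi (Suc i) - chi i) > 0" by (rule sum_pos) (use gap that in auto)
    then show ?thesis using that by (simp add: sum_Suc_diff')
  qed
  have F_nonneg: "0 \<le> F m j" if "j < m" "m \<le> N" for m j
    using v_ge_tangent[of "real m - real j" "chi m - chi j"] pos[OF that] that
    by (simp add: F_def d_def algebra_simps)
  have "(\<Sum>i<N. bond_excess (chi (Suc i) - chi i)) = (\<Sum>i<N. F (Suc i) i)"
    by (simp add: bond_excess_def F_def d_def algebra_simps)
  also have "\<dots> \<le> (\<Sum>i<N. \<Sum>j<Suc i. F (Suc i) j)"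
    by (intro sum_mono member_le_sum) (auto intro: F_nonneg)
  also have "\<dots> = (\<Sum>m\<le>N. \<Sum>j<m. F m j)"
    by (simp add: sum.atMost_shift)
  also have "\<dots> = energy N chi - energy N real - (\<Sum>m\<le>N. \<Sum>j<m. v1 (real m - real j) * (d m - d j))"
    by (simp add: F_def energy_def sum_subtractf)
  also have "(\<Sum>m\<le>N. \<Sum>j<m. v1 (real m - real j) * (d m - d j)) = (\<Sum>m\<le>N. \<Sum>j<m. A m j * (d m - d j))"
    by (intro sum.cong refl) (auto simp: A_def)
  also have "\<dots> = (\<Sum>i\<le>N. d i * (\<Sum>k\<le>N. A i k))"
  proof (rule sum_pairs_antisym)
    show "A k i = - A i k" for i k using v1_odd[of "real i - real k"] by (simp add: A_def)
  qed
  also have "\<dots> = (\<Sum>i\<le>N. d i * (tail_force i - tail_force (N - i)))"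
    by (intro sum.cong refl) (simp add: A_def lattice_force)
  finally have energy: "(\<Sum>i<N. bond_excess (chi (Suc i) - chi i))
      \<le> energy N chi - energy N real - (\<Sum>i\<le>N. d i * (tail_force i - tail_force (N - i)))" .
  \<comment> \<open>\<open>e\<close> keeps the negative part of the increments of \<open>d\<close>,
    so its sums bound those of \<open>d\<close> from below; Cauchy-Schwarz does the rest.\<close>
  have drift: "- (sqrt (real m - real j) * D) \<le> d m - d j" if "j \<le> m" "m \<le> N" for j m
  proof -
    define e where "e i = min 0 (chi (Suc i) - chi i - 1)" for i
    have "(\<Sum>i\<in>{j..<m}. e i)\<^sup>2 \<le> (\<Sum>i\<in>{j..<m}. (e i)\<^sup>2) * card {j..<m}"
      by (rule sum_squared_le_sum_of_squares)
    also have "\<dots> \<le> (\<Sum>i<N. (e i)\<^sup>2) * card {j..<m}"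
      using that by (intro mult_right_mono sum_mono2) auto
    finally have "\<bar>\<Sum>i\<in>{j..<m}. e i\<bar> \<le> sqrt ((\<Sum>i<N. (e i)\<^sup>2) * card {j..<m})"
      by (simp add: real_le_rsqrt)
    also have "\<dots> = sqrt (real m - real j) * D"
      using that by (simp add: D_def e_def real_sqrt_mult of_nat_diff mult.commute)
    finally have "- (sqrt (real m - real j) * D) \<le> (\<Sum>i\<in>{j..<m}. e i)" by linarith
    also have "\<dots> \<le> (\<Sum>i\<in>{j..<m}. d (Suc i) - d i)"
      by (intro sum_mono) (simp add: e_def d_def)
    also have "\<dots> = d m - d j" using that by (simp add: sum_Suc_diff')
    finally show ?thesis .
  qed
  have G: "(\<Sum>i\<le>N. sqrt (real i) * tail_force i) \<le> G"
    unfolding G_def by (intro sum_le_suminf summable_sqrt_tail_force) (auto simp: tail_force_nonneg)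
  have "(\<Sum>i\<le>N. sqrt (real (N - i)) * tail_force (N - i)) = (\<Sum>i\<le>N. sqrt (real i) * tail_force i)"
    by (rule sum.reindex_bij_witness[of _ "\<lambda>i. N - i" "\<lambda>i. N - i"]) auto
  then have "D * (\<Sum>i\<le>N. sqrt (real i) * tail_force i + sqrt (real (N - i)) * tail_force (N - i)) \<le> D * (2 * G)"
    using G \<open>D \<ge> 0\<close> by (intro mult_left_mono) (simp_all add: sum.distrib)
  moreover have "- (D * (\<Sum>i\<le>N. sqrt (real i) * tail_force i + sqrt (real (N - i)) * tail_force (N - i)))
      \<le> (\<Sum>i\<le>N. d i * (tail_force i - tail_force (N - i)))"
    unfolding sum_distrib_left sum_negf[symmetric]
  proof (rule sum_mono)
    fix i assume "i \<in> {..N}"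
    then have i: "i \<le> N" by simp
    \<comment> \<open>The lower bound is measured from the left end, the upper one from the right
      end, as \<open>d\<close> vanishes at both.\<close>
    have "- (sqrt (real i) * D) \<le> d i" "d i \<le> sqrt (real (N - i)) * D"
      using drift[of 0 i] drift[of i N] ends i by (simp_all add: d_def of_nat_diff)
    then have "- (sqrt (real i) * D) * tail_force i \<le> d i * tail_force i"
        "d i * tail_force (N - i) \<le> sqrt (real (N - i)) * D * tail_force (N - i)"
      by (intro mult_right_mono tail_force_nonneg; simp)+
    then show "- (D * (sqrt (real i) * tail_force i + sqrt (real (N - i)) * tail_force (N - i)))
        \<le> d i * (tail_force i - tail_force (N - i))"
      by (simp add: algebra_simps)
  qed
  ultimately show ?thesis using energy by (simp add: G_def[symmetric] algebra_simps)
qed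

text \<open>Compressed bonds have spacing at most 1, where strong convexity gives
  \<open>l / 2 * D\<^sup>2\<close> as a lower bound for the sum. Against the upper bound
  \<open>2 * D * G\<close> this yields \<open>D \<le> 4 * G / l\<close>, uniformly in
  \<open>N\<close>.\<close>

lemma bond_excess_sum_le:
  obtains B where "B \<ge> 0" "\<And>N chi. chi 0 = 0 \<Longrightarrow> chi N = real N \<Longrightarrow> (\<And>i. i < N \<Longrightarrow> 0 < chi (Suc i) - chi i)
     \<Longrightarrow> energy N chi \<le> energy N real \<Longrightarrow> (\<Sum>i<N. bond_excess (chi (Suc i) - chi i)) \<le> B"
proof -
  obtain l where l: "l > 0" "\<And>y. 0 < y \<Longrightarrow> y < 2 \<Longrightarrow> l \<le> v2 y"
    using v2_lower[of 2] by auto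
  define G where "G = (\<Sum>i. sqrt (real i) * tail_force i)"
  have "G \<ge> 0"
    unfolding G_def by (intro suminf_nonneg summable_sqrt_tail_force) (simp add: tail_force_nonneg)
  have "(\<Sum>i<N. bond_excess (chi (Suc i) - chi i)) \<le> 8 * G\<^sup>2 / l"
    if ends: "chi 0 = 0" "chi N = real N" and gap: "\<And>i. i < N \<Longrightarrow> 0 < chi (Suc i) - chi i"
      and le: "energy N chi \<le> energy N real" for N chi
  proof -
    define D where "D = sqrt (\<Sum>i<N. (min 0 (chi (Suc i) - chi i - 1))\<^sup>2)"
    let ?S = "\<Sum>i<N. bond_excess (chi (Suc i) - chi i)"
    have "D \<ge> 0" by (simp add: D_def sum_nonneg)
    have upper: "?S \<le> 2 * D * G"
      using energy_lower_bound[of chi N, OF ends gap] le by (simp add: D_def G_def)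
    have "l / 2 * D\<^sup>2 = (\<Sum>i<N. l / 2 * (min 0 (chi (Suc i) - chi i - 1))\<^sup>2)"
      by (simp add: D_def sum_nonneg sum_distrib_left)
    also have "\<dots> \<le> ?S"
    proof (rule sum_mono)
      fix i assume "i \<in> {..<N}"
      then have pos: "0 < chi (Suc i) - chi i" using gap by simp
      show "l / 2 * (min 0 (chi (Suc i) - chi i - 1))\<^sup>2 \<le> bond_excess (chi (Suc i) - chi i)"
      proof (cases "chi (Suc i) - chi i \<le> 1")
        case True
        then show ?thesis
          using v_ge_tangent_quadratic[of 2 l 1 "chi (Suc i) - chi i"] l pos
          by (simp add: bond_excess_def min_def)
      next
        case False
        then show ?thesis using bond_excess_nonneg[OF pos] by (simp add: min_def)
      qed
    qed
    also have "\<dots> \<le> 2 * D * G" by (rule upper)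
    finally have "l * D\<^sup>2 \<le> 4 * G * D" by (simp add: field_simps)
    then have "D \<le> 4 * G / l"
      using \<open>l > 0\<close> \<open>D \<ge> 0\<close> \<open>G \<ge> 0\<close> by (cases "D = 0") (auto simp: power2_eq_square field_simps)
    then have "2 * D * G \<le> 2 * (4 * G / l) * G"
      using \<open>G \<ge> 0\<close> by (intro mult_right_mono mult_left_mono) auto
    with upper show ?thesis by (simp add: power2_eq_square)
  qed
  moreover have "8 * G\<^sup>2 / l \<ge> 0" using l by simp
  ultimately show ?thesis using that by blast
qed

text \<open>A continuous function on a compact set; \<open>c \<le> 1\<close> makes the lattice a
  member, so the set is nonempty.\<close>

lemma energy_minimizer:
  assumes "0 < c" "c \<le> 1"
  obtains chi where "chi \<in> pinned_chains c N" "\<And>psi. psi \<in> pinned_chains c N \<Longrightarrow> energy N chi \<le> energy N psi"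
proof -
  have "continuous_on (pinned_chains c N) (energy N)"
    unfolding energy_def[abs_def]
  proof (intro continuous_on_sum)
    fix m j assume "m \<in> {..N}" "j \<in> {..<m}"
    then have jm: "j < m" "m \<le> N" by auto
    have "continuous_on {0<..} v"
      using DERIV_v by (auto intro!: continuous_at_imp_continuous_on DERIV_isCont)
    then show "continuous_on (pinned_chains c N) (\<lambda>chi. v (chi m - chi j))"
    proof (rule continuous_on_compose2)
      show "continuous_on (pinned_chains c N) (\<lambda>chi. chi m - chi j)"
        by (intro continuous_on_diff continuous_on_subset[OF continuous_on_product_coordinates] subset_UNIV)
      show "(\<lambda>chi. chi m - chi j) ` pinned_chains c N \<subseteq> {0<..}"
      proof (rule image_subsetI)
        fix chi assume "chi \<in> pinned_chains c N"
        then have "c * (real m - real j) \<le> chi m - chi j"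
          by (intro gap_le) (use jm in \<open>auto simp: pinned_chains_def\<close>)
        moreover have "0 < c * (real m - real j)" using jm assms by simp
        ultimately show "chi m - chi j \<in> {0<..}" by simp
      qed
    qed
  qed
  moreover have "(\<lambda>k. real (min k N)) \<in> pinned_chains c N"
    using assms by (auto simp: pinned_chains_def min_def)
  ultimately show ?thesis
    using continuous_attains_inf[OF compact_pinned_chains[of c N], of "energy N"] assms that
    by (metis empty_iff less_imp_le)
qed

text \<open>With strict spacing constraints particle \<open>i\<close> can be moved a little in both
  directions, and the derivative of the energy in this direction is the force on it.\<close>

lemma interior_minimizer_balanced:
  assumes chi: "chi \<in> pinned_chains c N" and "c > 0"
    and min: "\<And>psi. psi \<in> pinned_chains c N \<Longrightarrow> energy N chi \<le> energy N psi"
    and interior: "\<And>i. i < N \<Longrightarrow> c < chi (Suc i) - chi i"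
    and i: "1 \<le> i" "i < N"
  shows "(\<Sum>k\<le>N. if k = i then 0 else v1 (chi i - chi k)) = 0"
proof -
  define e where "e k = (if k = i then 1 else 0 :: real)" for k
  define A where "A m j = (if j = m then 0 else v1 (chi m - chi j))" for m j
  \<comment> \<open>Antisymmetry needs nonzero distances, which fails beyond \<open>N\<close>, where the chain is constant.\<close>
  define A' where "A' m j = (if m \<le> N \<and> j \<le> N then A m j else 0)" for m j
  define g where "g t = energy N (\<lambda>k. chi k + t * e k)" for t
  have gaps: "c \<le> chi (Suc i) - chi i" if "i < N" for i
    using chi that by (simp add: pinned_chains_def)
  have pos: "0 < chi m - chi j" if "j < m" "m \<le> N" for j m
  proof -
    have "c * (real m - real j) \<le> chi m - chi j" by (intro gap_le) (use that gaps in auto)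
    moreover have "0 < c * (real m - real j)" using that \<open>c > 0\<close> by simp
    ultimately show ?thesis by simp
  qed
  have anti: "A' k i = - A' i k" for i k
    using pos[of i k] pos[of k i] v1_odd[of "chi i - chi k"]
    by (cases i k rule: linorder_cases) (auto simp: A'_def A_def)
  have "(g has_real_derivative (\<Sum>m\<le>N. \<Sum>j<m. A' m j * (e m - e j))) (at 0)"
    unfolding g_def[abs_def] energy_def
  proof (intro DERIV_sum)
    fix m j assume "m \<in> {..N}" "j \<in> {..<m}"
    then have jm: "j < m" "m \<le> N" by auto
    have "((\<lambda>t. v ((chi m + t * e m) - (chi j + t * e j))) has_real_derivative v1 (chi m - chi j) * (e m - e j)) (at 0)"
    proof (rule DERIV_chain2[where f = v])
      show "(v has_real_derivative v1 (chi m - chi j)) (at (chi m + 0 * e m - (chi j + 0 * e j)))"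
        using DERIV_v[OF pos[OF jm]] by simp
    qed (auto intro!: derivative_eq_intros)
    then show "((\<lambda>t. v (chi m + t * e m - (chi j + t * e j))) has_real_derivative A' m j * (e m - e j)) (at 0)"
      using jm by (simp add: A'_def A_def)
  qed
  also have "(\<Sum>m\<le>N. \<Sum>j<m. A' m j * (e m - e j)) = (\<Sum>m\<le>N. e m * (\<Sum>k\<le>N. A' m k))"
    by (rule sum_pairs_antisym) (rule anti)
  also have "\<dots> = (\<Sum>k\<le>N. A' i k)"
    using i by (simp add: e_def sum.If_cases if_distrib[of "\<lambda>x. x * _"] cong: if_cong)
  also have "\<dots> = (\<Sum>k\<le>N. A i k)" using i by (simp add: A'_def)
  finally have deriv: "(g has_real_derivative (\<Sum>k\<le>N. A i k)) (at 0)" .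
  \<comment> \<open>The smallest slack in the constraints; moving one particle by \<open>t\<close>
    changes each spacing by at most the modulus of \<open>t\<close>.\<close>
  define \<eta> where "\<eta> = Min ((\<lambda>l. chi (Suc l) - chi l - c) ` {..<N})"
  have \<eta>_le: "\<eta> \<le> chi (Suc l) - chi l - c" if "l < N" for l
    unfolding \<eta>_def using that by (intro Min_le) auto
  have "\<eta> > 0" unfolding \<eta>_def using i interior by (subst Min_gr_iff) auto
  have "g 0 \<le> g t" if "\<bar>0 - t\<bar> < \<eta>" for t
  proof -
    have "(\<lambda>k. chi k + t * e k) \<in> pinned_chains c N"
    proof -
      have "c \<le> (chi (Suc l) + t * e (Suc l)) - (chi l + t * e l)" if "l < N" for l
        using \<eta>_le[OF that] \<open>\<bar>0 - t\<bar> < \<eta>\<close> by (auto simp: e_def)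
      then show ?thesis using chi i by (auto simp: pinned_chains_def e_def)
    qed
    from min[OF this] show ?thesis by (simp add: g_def)
  qed
  with DERIV_local_min[OF deriv \<open>\<eta> > 0\<close>] show ?thesis by (simp add: A_def)
qed

text \<open>The artificial constraint \<open>c\<close> is chosen so small that a single bond of
  length \<open>c\<close> would exceed the total excess allowed to a minimiser. It is therefore
  never active, and the minimiser is balanced. No constant depends on \<open>N\<close>.\<close>

lemma balanced_pinned_chains:
  obtains c M B where "0 < c" "1 \<le> M"
    "\<And>N. \<exists>chi\<in>pinned_chains c N. (\<forall>i<N. chi (Suc i) - chi i \<le> M) \<and>
       (\<Sum>i<N. (chi (Suc i) - chi i - 1)\<^sup>2) \<le> B \<and>
       (\<forall>i. 1 \<le> i \<longrightarrow> i < N \<longrightarrow> (\<Sum>k\<le>N. if k = i then 0 else v1 (chi i - chi k)) = 0)"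
proof -
  obtain B where "B \<ge> 0" and B: "\<And>N chi. chi 0 = 0 \<Longrightarrow> chi N = real N \<Longrightarrow>
      (\<And>i. i < N \<Longrightarrow> 0 < chi (Suc i) - chi i) \<Longrightarrow> energy N chi \<le> energy N real \<Longrightarrow>
      (\<Sum>i<N. bond_excess (chi (Suc i) - chi i)) \<le> B"
    using bond_excess_sum_le by blast
  have v1_1: "v1 1 < 0" by (rule v1_neg) simp
  have v_1: "v 1 > 0" by (rule v_pos) simp
  \<comment> \<open>\<open>- v1 1\<close> makes up for the linear term of
    \<open>bond_excess\<close>, since \<open>1 - s\<close> is at most 1 for positive
    \<open>s\<close>.\<close>
  have "eventually (\<lambda>x. B + v 1 - v1 1 < v x) (at_right 0)"
    using v_at_0 by (simp add: filterlim_at_top_dense)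
  then obtain b where b: "b > 0" "\<And>x. 0 < x \<Longrightarrow> x < b \<Longrightarrow> B + v 1 - v1 1 < v x"
    by (auto simp: eventually_at_right_field)
  define c where "c = min 1 (b / 2)"
  have c: "0 < c" "c \<le> 1" "B + v 1 - v1 1 < v c"
    using b(1) b(2)[of c] by (auto simp: c_def min_def)
  have c_excess: "B < bond_excess c"
  proof -
    have "v1 1 * (c - 1) \<le> - v1 1 * 1"
      using c v1_1 mult_left_mono[of "1 - c" 1 "- v1 1"] by (simp add: algebra_simps)
    then show ?thesis using c(3) by (simp add: bond_excess_def)
  qed
  \<comment> \<open>Solves \<open>- v1 1 * (s - 1) \<le> B + v 1\<close> for the spacing
    \<open>s\<close>.\<close>
  define M where "M = 1 + (B + v 1) / (- v1 1)"
  have "M \<ge> 1" using \<open>B \<ge> 0\<close> v_1 v1_1 by (simp add: M_def divide_nonneg_neg)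
  have le_M: "s \<le> M" if "s > 0" "bond_excess s \<le> B" for s
  proof -
    have "- v1 1 * (s - 1) \<le> B + v 1"
      using that v_pos[of s] by (simp add: bond_excess_def)
    then show ?thesis using v1_1 by (simp add: M_def field_simps)
  qed
  \<comment> \<open>With all spacings in \<open>(0, M]\<close> the convexity modulus is uniform, so
    the excess controls the squared deviations of stretched bonds too.\<close>
  obtain l where l: "l > 0" "\<And>y. 0 < y \<Longrightarrow> y < M + 1 \<Longrightarrow> l \<le> v2 y"
    using v2_lower[of "M + 1"] \<open>M \<ge> 1\<close> by auto
  have "\<exists>chi\<in>pinned_chains c N. (\<forall>i<N. chi (Suc i) - chi i \<le> M) \<and>
       (\<Sum>i<N. (chi (Suc i) - chi i - 1)\<^sup>2) \<le> 2 / l * B \<and>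
       (\<forall>i. 1 \<le> i \<longrightarrow> i < N \<longrightarrow> (\<Sum>k\<le>N. if k = i then 0 else v1 (chi i - chi k)) = 0)" for N
  proof -
    obtain chi where chi: "chi \<in> pinned_chains c N"
      and min: "\<And>psi. psi \<in> pinned_chains c N \<Longrightarrow> energy N chi \<le> energy N psi"
      using energy_minimizer[OF c(1,2)] by metis
    have ends: "chi 0 = 0" "chi N = real N" and gap_c: "\<And>i. i < N \<Longrightarrow> c \<le> chi (Suc i) - chi i"
      using chi by (auto simp: pinned_chains_def)
    have gap: "0 < chi (Suc i) - chi i" if "i < N" for i using gap_c[OF that] c by simp
    \<comment> \<open>The lattice itself is not frozen beyond \<open>N\<close>; truncating it gives
      a competitor with the same energy.\<close>
    have "energy N chi \<le> energy N (\<lambda>k. real (min k N))"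
      by (rule min) (use c in \<open>auto simp: pinned_chains_def min_def\<close>)
    also have "\<dots> = energy N real"
      unfolding energy_def by (intro sum.cong refl) (auto simp: min_def)
    finally have le_B: "(\<Sum>i<N. bond_excess (chi (Suc i) - chi i)) \<le> B"
      using B[of chi N] ends gap by blast
    have excess: "bond_excess (chi (Suc i) - chi i) \<le> B" if "i < N" for i
    proof -
      have "bond_excess (chi (Suc i) - chi i) \<le> (\<Sum>i<N. bond_excess (chi (Suc i) - chi i))"
        by (rule member_le_sum[of i "{..<N}" "\<lambda>i. bond_excess (chi (Suc i) - chi i)"])
           (use that gap bond_excess_nonneg in auto)
      with le_B show ?thesis by simp
    qed
    have upper: "chi (Suc i) - chi i \<le> M" if "i < N" for i
      using le_M gap excess that by blast
    have "l / 2 * (\<Sum>i<N. (chi (Suc i) - chi i - 1)\<^sup>2) \<le> (\<Sum>i<N. bond_excess (chi (Suc i) - chi i))"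
      unfolding sum_distrib_left
    proof (rule sum_mono)
      fix i assume "i \<in> {..<N}"
      then have "0 < chi (Suc i) - chi i" "chi (Suc i) - chi i < M + 1"
        using gap[of i] upper[of i] by auto
      then show "l / 2 * (chi (Suc i) - chi i - 1)\<^sup>2 \<le> bond_excess (chi (Suc i) - chi i)"
        unfolding bond_excess_def using l(2) \<open>M \<ge> 1\<close> by (intro v_ge_tangent_quadratic) auto
    qed
    then have sq: "(\<Sum>i<N. (chi (Suc i) - chi i - 1)\<^sup>2) \<le> 2 / l * B"
      using le_B l(1) by (simp add: field_simps)
    have "c < chi (Suc i) - chi i" if "i < N" for i
      using gap_c[OF that] excess[OF that] c_excess by (cases "c = chi (Suc i) - chi i") auto
    then have "(\<Sum>k\<le>N. if k = i then 0 else v1 (chi i - chi k)) = 0" if "1 \<le> i" "i < N" for i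
      using interior_minimizer_balanced[OF chi c(1) min] that by blast
    with chi upper sq show ?thesis by blast
  qed
  with c \<open>M \<ge> 1\<close> show ?thesis using that by blast
qed

section \<open>Passage to the infinite chain\<close>

lemma isCont_v1:
  assumes "x \<noteq> 0"
  shows "isCont v1 x"
proof (cases "x > 0")
  case True
  then show ?thesis by (rule DERIV_isCont[OF DERIV_v1])
next
  case False
  then have "x < 0" using assms by simp
  then have "isCont v1 (- x)" by (intro DERIV_isCont[OF DERIV_v1]) simp
  then have "isCont (\<lambda>y. - v1 (- y)) x"
    by (intro continuous_intros isCont_o2[where g = v1 and f = uminus])
  moreover have "eventually (\<lambda>y. - v1 (- y) = v1 y) (nhds x)"
    using eventually_nhds_in_open[of "{..<0}" x] \<open>x < 0\<close>
    by (auto elim!: eventually_mono simp: v1_odd)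
  ultimately show ?thesis by (simp add: isCont_cong)
qed

lemma summable_distance_powr:
  assumes "s < -1"
  shows "summable (\<lambda>k. \<bar>real i - real k\<bar> powr s)"
proof -
  have "summable (\<lambda>k. \<bar>real i - real (k + Suc i)\<bar> powr s)"
    using summable_Suc_powr[OF assms] by (simp add: algebra_simps)
  then show ?thesis by (subst (asm) summable_iff_shift)
qed

lemma force_balance_exists:
  obtains chi c B where "c > 0" "chi 0 = 0" "\<And>i. c \<le> chi (Suc i) - chi i"
    "\<And>n. (\<Sum>i<n. (chi (Suc i) - chi i - 1)\<^sup>2) \<le> B"
    "\<And>i. 1 \<le> i \<Longrightarrow> (\<lambda>k. if k = i then 0 else v1 (chi i - chi k)) sums 0"
proof -
  define balanced where "balanced c M B N chi \<longleftrightarrow> chi \<in> pinned_chains c N \<and>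
      (\<forall>i<N. chi (Suc i) - chi i \<le> M) \<and> (\<Sum>i<N. (chi (Suc i) - chi i - 1)\<^sup>2) \<le> B \<and>
      (\<forall>i. 1 \<le> i \<longrightarrow> i < N \<longrightarrow> (\<Sum>k\<le>N. if k = i then 0 else v1 (chi i - chi k)) = 0)"
    for c M B N chi
  obtain c M B where "0 < c" "1 \<le> M" and chains: "\<forall>N. \<exists>chi. balanced c M B N chi"
    by (rule balanced_pinned_chains) (auto simp: balanced_def Bex_def)
  from choice[OF chains] obtain X where "\<forall>N. balanced c M B N (X N)" ..
  then have X: "X N \<in> pinned_chains c N" "i < N \<Longrightarrow> X N (Suc i) - X N i \<le> M"
    "(\<Sum>i<N. (X N (Suc i) - X N i - 1)\<^sup>2) \<le> B"
    "1 \<le> i \<Longrightarrow> i < N \<Longrightarrow> (\<Sum>k\<le>N. if k = i then 0 else v1 (X N i - X N k)) = 0" for N i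
    by (auto simp: balanced_def)
  have gap: "c \<le> X N (Suc i) - X N i" if "i < N" for N i
    using X(1)[of N] that by (simp add: pinned_chains_def)
  \<comment> \<open>A coordinatewise bound that is uniform in \<open>N\<close> places all the chains
    in one compact box.\<close>
  have "0 \<le> X N k \<and> X N k \<le> M * real k" for N k
  proof
    show "0 \<le> X N k" using pinned_chain_bounds(1)[OF X(1)] \<open>0 < c\<close> by simp
    show "X N k \<le> M * real k"
    proof (cases "k \<le> N")
      case True
      \<comment> \<open>Upper bounds on spacings are lower bounds for the negated chain.\<close>
      have "- M * (real k - real 0) \<le> - X N k - (- X N 0)"
        by (rule gap_le[where chi = "\<lambda>k. - X N k"]) (use X(2) True in \<open>auto simp: algebra_simps\<close>)
      moreover have "X N 0 = 0" using X(1)[of N] by (simp add: pinned_chains_def)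
      ultimately show ?thesis by simp
    next
      case False
      then have "X N k = real N" using X(1)[of N] by (simp add: pinned_chains_def)
      also have "\<dots> \<le> 1 * real k" using False by simp
      also have "\<dots> \<le> M * real k" using \<open>1 \<le> M\<close> by (intro mult_right_mono) auto
      finally show ?thesis .
    qed
  qed
  then have "\<forall>N. X N \<in> {f. \<forall>k. 0 \<le> f k \<and> f k \<le> M * real k}" by blast
  moreover have "seq_compact {f :: nat \<Rightarrow> real. \<forall>k. 0 \<le> f k \<and> f k \<le> M * real k}"
    by (intro compact_imp_seq_compact compact_box)
  ultimately obtain chi r where r: "strict_mono r" and lim: "(X \<circ> r) \<longlonglongrightarrow> chi"
    unfolding seq_compact_def by blast
  have conv: "(\<lambda>n. X (r n) k) \<longlonglongrightarrow> chi k" for k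
    using continuous_on_tendsto_compose[OF continuous_on_product_coordinates[of k] lim] by simp
  have large: "eventually (\<lambda>n. i < r n) sequentially" for i
    using filterlim_subseq[OF r] eventually_gt_at_top[of i] by (simp add: filterlim_iff)
  have "X (r n) 0 = 0" for n using X(1)[of "r n"] by (simp add: pinned_chains_def)
  then have chi_0: "chi 0 = 0" using conv[of 0] by (simp add: LIMSEQ_const_iff)
  have chi_gap: "c \<le> chi (Suc i) - chi i" for i
  proof (rule tendsto_lowerbound)
    show "(\<lambda>n. X (r n) (Suc i) - X (r n) i) \<longlonglongrightarrow> chi (Suc i) - chi i"
      by (intro tendsto_diff conv)
    show "\<forall>\<^sub>F n in sequentially. c \<le> X (r n) (Suc i) - X (r n) i"
      using large[of i] by eventually_elim (rule gap)
  qed simp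
  have chi_l2: "(\<Sum>i<n. (chi (Suc i) - chi i - 1)\<^sup>2) \<le> B" for n
  proof (rule tendsto_upperbound)
    show "(\<lambda>k. \<Sum>i<n. (X (r k) (Suc i) - X (r k) i - 1)\<^sup>2) \<longlonglongrightarrow> (\<Sum>i<n. (chi (Suc i) - chi i - 1)\<^sup>2)"
      by (intro tendsto_intros conv)
    show "\<forall>\<^sub>F k in sequentially. (\<Sum>i<n. (X (r k) (Suc i) - X (r k) i - 1)\<^sup>2) \<le> B"
      using large[of n]
    proof eventually_elim
      case (elim k)
      have "(\<Sum>i<n. (X (r k) (Suc i) - X (r k) i - 1)\<^sup>2) \<le> (\<Sum>i<r k. (X (r k) (Suc i) - X (r k) i - 1)\<^sup>2)"
        by (rule sum_mono2) (use elim in auto)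
      with X(3)[of "r k"] show ?case by simp
    qed
  qed simp
  obtain C where C: "C > 0" "\<And>x. x \<ge> c \<Longrightarrow> - v1 x \<le> C * x powr (- a - 1)"
    using v1_decay[OF \<open>0 < c\<close>] by blast
  \<comment> \<open>The bound depends on the index distance but not on \<open>N\<close>, so it
    serves as the dominating series.\<close>
  have force_bound: "\<bar>v1 (X N i - X N k)\<bar> \<le> C * c powr (- a - 1) * \<bar>real i - real k\<bar> powr (- a - 1)"
    if "i \<le> N" "k \<le> N" "i \<noteq> k" for i k N
  proof -
    have ordered: "v1 (X N m - X N j) < 0 \<and> X N m - X N j > 0 \<and>
        - v1 (X N m - X N j) \<le> C * c powr (- a - 1) * (real m - real j) powr (- a - 1)"
      if "j < m" "m \<le> N" for j m
    proof -
      have le: "c * (real m - real j) \<le> X N m - X N j" by (rule gap_le) (use gap that in auto)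
      have ge: "c \<le> c * (real m - real j)" using \<open>0 < c\<close> that by simp
      have "- v1 (X N m - X N j) \<le> - v1 (c * (real m - real j))"
        using v1_mono[OF _ le] ge \<open>0 < c\<close> by simp
      also have "\<dots> \<le> C * (c * (real m - real j)) powr (- a - 1)" by (rule C(2)[OF ge])
      also have "(c * (real m - real j)) powr (- a - 1) = c powr (- a - 1) * (real m - real j) powr (- a - 1)"
        using \<open>0 < c\<close> that by (simp add: powr_mult)
      finally have "- v1 (X N m - X N j) \<le> C * c powr (- a - 1) * (real m - real j) powr (- a - 1)"
        by (simp add: mult.assoc)
      moreover have "X N m - X N j > 0" using le ge \<open>0 < c\<close> by linarith
      ultimately show ?thesis using v1_neg by blast
    qed
    show ?thesis
    proof (cases "k < i")
      case True
      then show ?thesis using ordered[of k i] that by simp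
    next
      case False
      then have "i < k" using that by simp
      then show ?thesis
        using ordered[of i k] that v1_odd[of "X N k - X N i"] by (simp add: abs_minus_commute)
    qed
  qed
  have balance: "(\<lambda>k. if k = i then 0 else v1 (chi i - chi k)) sums 0" if "1 \<le> i" for i
  proof -
    \<comment> \<open>Cutting off \<open>k\<close> beyond \<open>r n\<close> makes the series
      finite; setting everything to 0 while \<open>i\<close> exceeds \<open>r n\<close> makes the
      domination valid for every \<open>n\<close>.\<close>
    define f where "f k n = (if k = i \<or> k > r n \<or> i > r n then 0 else v1 (X (r n) i - X (r n) k))" for k n
    have chi_neq: "chi i - chi k \<noteq> 0" if "k \<noteq> i" for k
    proof -
      have "0 < chi m - chi j" if "j < m" for j m
      proof -
        have "c * (real m - real j) \<le> chi m - chi j" by (rule gap_le) (use chi_gap that in auto)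
        moreover have "0 < c * (real m - real j)" using that \<open>0 < c\<close> by simp
        ultimately show ?thesis by simp
      qed
      from this[of k i] this[of i k] show ?thesis using that by (cases "k < i") auto
    qed
    have tannery: "summable (\<lambda>k. norm (if k = i then 0 else v1 (chi i - chi k))) \<and>
        (\<lambda>n. \<Sum>k. f k n) \<longlonglongrightarrow> (\<Sum>k. if k = i then 0 else v1 (chi i - chi k))"
    proof (rule tannerys_theorem[THEN conjunct2])
      show "(\<lambda>n. f k n) \<longlonglongrightarrow> (if k = i then 0 else v1 (chi i - chi k))" for k
      proof (cases "k = i")
        case False
        have "(\<lambda>n. v1 (X (r n) i - X (r n) k)) \<longlonglongrightarrow> v1 (chi i - chi k)"
          by (intro isCont_tendsto_compose[OF isCont_v1] chi_neq False tendsto_diff conv)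
        moreover have "eventually (\<lambda>n. v1 (X (r n) i - X (r n) k) = f k n) sequentially"
          using large[of i] large[of k] by eventually_elim (use False in \<open>auto simp: f_def\<close>)
        ultimately show ?thesis using False by (auto intro: Lim_transform_eventually)
      qed (simp add: f_def)
      show "summable (\<lambda>k. C * c powr (- a - 1) * \<bar>real i - real k\<bar> powr (- a - 1))"
        by (intro summable_mult summable_distance_powr) (use a_gt in simp)
      have "norm (f k n) \<le> C * c powr (- a - 1) * \<bar>real i - real k\<bar> powr (- a - 1)" for k n
        using force_bound[of i "r n" k] C(1) by (auto simp: f_def)
      then show "\<forall>\<^sub>F (k, n) in sequentially \<times>\<^sub>F sequentially.
          norm (f k n) \<le> C * c powr (- a - 1) * \<bar>real i - real k\<bar> powr (- a - 1)"
        by (intro always_eventually) auto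
    qed simp
    \<comment> \<open>Once \<open>i < r n\<close>, particle \<open>i\<close> is interior to the
      finite chain and exactly balanced.\<close>
    have "eventually (\<lambda>n. (\<Sum>k. f k n) = 0) sequentially"
      using large[of i]
    proof eventually_elim
      case (elim n)
      have "(\<Sum>k. f k n) = (\<Sum>k\<le>r n. f k n)" by (rule suminf_finite) (auto simp: f_def)
      also have "\<dots> = (\<Sum>k\<le>r n. if k = i then 0 else v1 (X (r n) i - X (r n) k))"
        by (intro sum.cong refl) (use elim in \<open>auto simp: f_def\<close>)
      finally show ?case using X(4)[of i "r n"] elim that by simp
    qed
    then have "(\<lambda>n. \<Sum>k. f k n) \<longlonglongrightarrow> 0" by (rule tendsto_eventually)
    then have "(\<Sum>k. if k = i then 0 else v1 (chi i - chi k)) = 0"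
      using tannery LIMSEQ_unique by blast
    then show ?thesis
      using tannery summable_norm_cancel[of "\<lambda>k. if k = i then 0 else v1 (chi i - chi k)"]
      by (simp add: sums_iff)
  qed
  show ?thesis using that[OF \<open>0 < c\<close> chi_0 chi_gap chi_l2 balance] .
qed

end

section \<open>Admissible potentials\<close>

lemma tendsto_enn2real_0:
  assumes "(f \<longlongrightarrow> 0) F"
  shows "((\<lambda>x. enn2real (f x)) \<longlongrightarrow> 0) F"
  using tendsto_enn2real[of f 0 F] assms by simp

lemma admissible_potential_decaying_convex:
  assumes "admissible_potential V"
  obtains a where "decaying_convex_potential (\<lambda>x. enn2real (V x)) (pot_deriv V) (pot_deriv2 V) a"
proof -
  let ?v = "\<lambda>x. enn2real (V x)"
  have fin: "0 < V x \<and> V x < \<infinity>" if "x \<noteq> 0" for x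
    using assms that by (simp add: admissible_potential_def)
  have even: "V (- x) = V x" for x using assms by (simp add: admissible_potential_def)
  have D1: "(?v has_real_derivative pot_deriv V x) (at x)" if "x \<noteq> 0" for x
    using assms that unfolding admissible_potential_def pot_deriv_def
    by (simp add: DERIV_deriv_iff_field_differentiable)
  have D2: "(pot_deriv V has_real_derivative pot_deriv2 V x) (at x)" if "x \<noteq> 0" for x
    using assms that unfolding admissible_potential_def pot_deriv2_def
    by (simp add: DERIV_deriv_iff_field_differentiable)
  obtain a c where a: "a > 3/2" and c: "\<And>\<delta> x. \<delta> > 0 \<Longrightarrow> x \<notin> {-\<delta><..<\<delta>} \<Longrightarrow>
      pot_deriv2 V x \<le> c \<delta> * \<bar>x\<bar> powr (- a - 2)"
    using assms unfolding admissible_potential_def by blast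
  have "decaying_convex_potential ?v (pot_deriv V) (pot_deriv2 V) a"
  proof
    fix x :: real
    show "0 < enn2real (V x)" if "x > 0"
      using fin[of x] that by (simp add: enn2real_positive_iff)
    show "(?v has_real_derivative pot_deriv V x) (at x)" if "x > 0" using D1 that by simp
    show "(pot_deriv V has_real_derivative pot_deriv2 V x) (at x)" if "x > 0" using D2 that by simp
    \<comment> \<open>Differentiate the evenness of the potential and use uniqueness of the
      derivative.\<close>
    show "pot_deriv V (- x) = - pot_deriv V x" if "x \<noteq> 0"
    proof -
      have "((\<lambda>x. ?v (- x)) has_real_derivative pot_deriv V (- x) * (- 1)) (at x)"
        by (rule DERIV_chain2[where f = ?v]) (use D1[of "- x"] that in \<open>auto intro!: derivative_eq_intros\<close>)
      then have "(?v has_real_derivative - pot_deriv V (- x)) (at x)" by (simp add: even)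
      with D1[OF that] have "pot_deriv V x = - pot_deriv V (- x)" by (rule DERIV_unique)
      then show ?thesis by simp
    qed
    show "\<exists>l>0. \<forall>y\<in>{0<..<x}. l \<le> pot_deriv2 V y" if "x > 0"
      using assms that by (simp add: admissible_potential_def)
  next
    show "filterlim ?v at_top (at_right 0)"
      unfolding filterlim_at_top
    proof
      fix Z :: real
      have "V 0 = \<infinity>" "(V \<longlongrightarrow> V 0) (at 0)"
        using assms unfolding admissible_potential_def by blast+
      then have "(V \<longlongrightarrow> \<infinity>) (at 0)" by simp
      then have "(V \<longlongrightarrow> \<infinity>) (at_right 0)" by (rule filterlim_mono) (auto simp: at_within_le_at)
      then have "\<forall>\<^sub>F x in at_right 0. ennreal Z < V x"
        by (rule order_tendstoD) simp
      \<comment> \<open>\<open>enn2real\<close> sends infinity to 0, so the origin has to be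
        excluded before passing to real values.\<close>
      moreover have "\<forall>\<^sub>F x in at_right 0. (x :: real) \<noteq> 0"
        by (simp add: eventually_at_filter)
      ultimately show "\<forall>\<^sub>F x in at_right 0. Z \<le> ?v x"
      proof eventually_elim
        case (elim x)
        then have "V x = ennreal (?v x)" using fin[of x] by (simp add: less_top)
        with elim have "ennreal Z < ennreal (?v x)" by simp
        then show ?case by (meson ennreal_leI linorder_not_le less_imp_le)
      qed
    qed
    show "(?v \<longlongrightarrow> 0) at_top"
      using assms unfolding admissible_potential_def
      by (intro tendsto_enn2real_0) (auto intro: tendsto_mono[OF at_top_le_at_infinity])
    show "(pot_deriv V \<longlongrightarrow> 0) at_top"
      using assms unfolding admissible_potential_def
      by (auto intro: tendsto_mono[OF at_top_le_at_infinity])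
    show "\<exists>C. \<forall>x\<ge>\<delta>. pot_deriv2 V x \<le> C * x powr (- a - 2)" if "\<delta> > 0" for \<delta>
    proof (intro exI[of _ "c \<delta>"] allI impI)
      show "pot_deriv2 V x \<le> c \<delta> * x powr (- a - 2)" if "\<delta> \<le> x" for x
        using c[of \<delta> x] that \<open>\<delta> > 0\<close> by simp
    qed
    show "a > 3/2" by (rule a)
  qed
  then show ?thesis by (rule that)
qed

lemma ell2_iff_summable: "f \<in> ell2 \<longleftrightarrow> summable (\<lambda>i. (f (Suc i))\<^sup>2)"
proof -
  have "{1..} = range Suc" by (auto simp: image_iff Suc_le_eq gr0_conv_Suc)
  then have "f \<in> ell2 \<longleftrightarrow> (\<lambda>i. (f i)\<^sup>2) summable_on range Suc" by (simp add: ell2_def)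
  also have "\<dots> \<longleftrightarrow> ((\<lambda>i. (f i)\<^sup>2) \<circ> Suc) summable_on UNIV"
    by (rule summable_on_reindex) simp
  finally show ?thesis by (simp add: o_def summable_on_UNIV_nonneg_real_iff)
qed

text \<open>Injectivity excludes an excess of exactly -1, so all spacings are positive. Square
  summability makes all but finitely many exceed 1/2, and the minimum over the rest is
  positive.\<close>

lemma uniform_gap:
  fixes chi :: "nat \<Rightarrow> real"
  assumes "inj chi" "spacing_excess chi \<in> ell2" "\<And>i. i \<ge> 1 \<Longrightarrow> spacing_excess chi i \<ge> -1"
  obtains c where "c > 0" "\<And>i. c \<le> chi (Suc i) - chi i"
proof -
  define g where "g i = chi (Suc i) - chi i" for i
  have pos: "g i > 0" for i
    using assms(3)[of "Suc i"] injD[OF assms(1), of "Suc i" i]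
    by (force simp: g_def spacing_excess_def)
  have "(\<lambda>i. (g i - 1)\<^sup>2) \<longlonglongrightarrow> 0"
    using assms(2) by (intro summable_LIMSEQ_zero) (simp add: ell2_iff_summable spacing_excess_def g_def)
  then have "(\<lambda>i. sqrt ((g i - 1)\<^sup>2)) \<longlonglongrightarrow> sqrt 0" by (rule tendsto_real_sqrt)
  then have "\<forall>\<^sub>F i in sequentially. \<bar>g i - 1\<bar> < 1/2"
    by (intro order_tendstoD(2)) auto
  then obtain n where n: "\<And>i. i \<ge> n \<Longrightarrow> \<bar>g i - 1\<bar> < 1/2" by (auto simp: eventually_sequentially)
  define c where "c = Min (insert (1/2) (g ` {..<n}))"
  have "c > 0" unfolding c_def by (subst Min_gr_iff) (auto simp: pos)
  moreover have "c \<le> g i" for i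
  proof (cases "i < n")
    case True
    then show ?thesis unfolding c_def by (intro Min_le) auto
  next
    case False
    have "c \<le> 1/2" unfolding c_def by (intro Min_le) auto
    then show ?thesis using n[of i] False by linarith
  qed
  ultimately show ?thesis using that by (auto simp: g_def)
qed

theorem mainTheorem3:
  fixes V :: "real \<Rightarrow> ennreal"
  assumes "admissible_potential V"
  shows "\<exists>!chi :: nat \<Rightarrow> real. chi 0 = 0 \<and> force_balanced V chi \<and>
           spacing_excess chi \<in> ell2 \<and> (\<forall>i\<ge>1. spacing_excess chi i \<ge> -1)"
proof -
  obtain a where "decaying_convex_potential (\<lambda>x. enn2real (V x)) (pot_deriv V) (pot_deriv2 V) a"
    using admissible_potential_decaying_convex[OF assms] by blast
  then interpret decaying_convex_potential "\<lambda>x. enn2real (V x)" "pot_deriv V" "pot_deriv2 V" a .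
  show ?thesis
  proof (rule ex_ex1I)
    obtain chi c B where chi: "c > 0" "chi 0 = 0" "\<And>i. c \<le> chi (Suc i) - chi i"
      "\<And>n. (\<Sum>i<n. (chi (Suc i) - chi i - 1)\<^sup>2) \<le> B"
      "\<And>i. 1 \<le> i \<Longrightarrow> (\<lambda>k. if k = i then 0 else pot_deriv V (chi i - chi k)) sums 0"
      by (rule force_balance_exists) (rule that)
    have "strict_mono chi"
      unfolding strict_mono_Suc_iff using chi(1,3) by (metis diff_gt_0_iff_gt less_le_trans)
    then have "inj chi" by (rule strict_mono_imp_inj_on)
    moreover have "spacing_excess chi \<in> ell2"
      unfolding ell2_iff_summable spacing_excess_def
      by (rule summableI_nonneg_bounded[where x = B]) (use chi(4) in auto)
    moreover have "spacing_excess chi i \<ge> -1" if "i \<ge> 1" for i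
      using chi(1) chi(3)[of "i - 1"] that by (simp add: spacing_excess_def)
    ultimately show "\<exists>chi :: nat \<Rightarrow> real. chi 0 = 0 \<and> force_balanced V chi \<and>
           spacing_excess chi \<in> ell2 \<and> (\<forall>i\<ge>1. spacing_excess chi i \<ge> -1)"
      using chi(2,5) unfolding force_balanced_def by blast
  next
    fix chi psi :: "nat \<Rightarrow> real"
    assume chi: "chi 0 = 0 \<and> force_balanced V chi \<and>
           spacing_excess chi \<in> ell2 \<and> (\<forall>i\<ge>1. spacing_excess chi i \<ge> -1)"
      and psi: "psi 0 = 0 \<and> force_balanced V psi \<and>
           spacing_excess psi \<in> ell2 \<and> (\<forall>i\<ge>1. spacing_excess psi i \<ge> -1)"
    obtain c where c: "c > 0" "\<And>i. c \<le> chi (Suc i) - chi i"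
      using uniform_gap[of chi] chi by (auto simp: force_balanced_def)
    obtain c' where c': "c' > 0" "\<And>i. c' \<le> psi (Suc i) - psi i"
      using uniform_gap[of psi] psi by (auto simp: force_balanced_def)
    have "summable (\<lambda>i. 2 * (spacing_excess chi (Suc i))\<^sup>2 + 2 * (spacing_excess psi (Suc i))\<^sup>2)"
      using chi psi by (intro summable_add summable_mult) (auto simp: ell2_iff_summable)
    \<comment> \<open>The increments of \<open>chi - psi\<close> are differences of the two spacing
      excesses.\<close>
    then have l2: "summable (\<lambda>p. ((chi (Suc p) - psi (Suc p)) - (chi p - psi p))\<^sup>2)"
    proof (rule summable_comparison_test')
      fix p
      define x where "x = spacing_excess chi (Suc p)"
      define y where "y = spacing_excess psi (Suc p)"
      have "(chi (Suc p) - psi (Suc p)) - (chi p - psi p) = x - y"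
        by (simp add: x_def y_def spacing_excess_def)
      moreover have "(x - y)\<^sup>2 \<le> 2 * x\<^sup>2 + 2 * y\<^sup>2"
        using zero_le_power2[of "x + y"] by (simp add: power2_sum power2_diff)
      ultimately show "norm (((chi (Suc p) - psi (Suc p)) - (chi p - psi p))\<^sup>2)
          \<le> 2 * (spacing_excess chi (Suc p))\<^sup>2 + 2 * (spacing_excess psi (Suc p))\<^sup>2"
        by (simp add: x_def y_def)
    qed
    show "chi = psi"
    proof (rule force_balance_unique[of "min c c'" chi psi, OF _ _ _ _ _ _ l2])
      show "0 < min c c'" using c c' by simp
      show "min c c' \<le> chi (Suc i) - chi i" "min c c' \<le> psi (Suc i) - psi i" for i
        using c(2)[of i] c'(2)[of i] by auto
    qed (use chi psi in \<open>auto simp: force_balanced_def\<close>)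
  qed
qed

end
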